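(* Let $G$ and $H$ be finite simple graphs, neither of which is the path on three vertices $P_3$ or the $4$-cycle $C_4$. Let $S$ be a minimum edge-cut in $G\times H$, and let $B$ and $W$ be the (two) connected components of $(G\times H)-S$. Then $S$ is of type 1, 2, 3, 4, 5, 6, 7 or 8.
   Context: The direct product $G\times H$ has vertex set $V(G)\times V(H)$, with $(x_1,y_1)$ adjacent to $(x_2,y_2)$ if and only if $x_1x_2\in E(G)$ and $y_1y_2\in E(H)$. An edge-cut is a set of edges whose removal disconnects the graph; a minimum edge-cut is one of minimum size. When $S$ is a minimum edge-cut of $G\times H$, its "connected components" $B$ (black) and $W$ (white) are the two connected components of $(G\times H)-S$ (the convention presupposes exactly two components). The types are the following shapes of the pair $(B,W)$ (up to interchanging the names $B$ and $W$), where all sets written as partitions are disjoint unions: Type 1: $B=B'\times V(H)$, $W=W'\times V(H)$ with $V(G)=B'\cup W'$. Type 2: $B=V(G)\times B'$, $W=V(G)\times W'$ with $V(H)=B'\cup W'$. Type 3: $|B|=1$ or $|W|=1$. Type 4: $V(G)=X_1\cup X_2$, $V(H)=Y_1\cup Y_2$, $B=(X_1\times Y_1)\cup(X_2\times Y_2)$, $W=(X_1\times Y_2)\cup(X_2\times Y_1)$. Type 5: $V(G)=A_1\cup A_2\cup A_3$, $V(H)=C\cup D$, $B=(A_1\times C)\cup(A_2\times D)$, $W=(A_1\times D)\cup(A_2\times C)\cup(A_3\times V(H))$. Type 6: $V(G)=X\cup Y$, $V(H)=C_1\cup C_2\cup C_3$, $B=(X\times C_1)\cup(Y\times C_2)$,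 $W=(X\times C_2)\cup(Y\times C_1)\cup(V(G)\times C_3)$. Type 7: $V(G)=A_1\cup A_2\cup A_3\cup A_4$, $V(H)=C\cup D$, $B=(A_1\times C)\cup(A_2\times D)\cup(A_4\times V(H))$, $W=(A_1\times D)\cup(A_2\times C)\cup(A_3\times V(H))$. Type 8: $V(G)=X\cup Y$, $V(H)=C_1\cup C_2\cup C_3\cup C_4$, $B=(X\times C_1)\cup(Y\times C_2)\cup(V(G)\times C_4)$, $W=(X\times C_2)\cup(Y\times C_1)\cup(V(G)\times C_3)$. (In the paper these types are given by a figure: in types 5 and 7 each $H$-layer $\{x\}\times V(H)$ is either monochromatic or split along a fixed partition $C\cup D$, and types 6 and 8 are the analogous shapes with the roles of $G$ and $H$ interchanged.) *)

theory Defs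
  imports Main
begin

definition simple_graph :: "'a set \<Rightarrow> 'a set set \<Rightarrow> bool" where
  "simple_graph V E \<longleftrightarrow> finite V \<and>
     (\<forall>e\<in>E. \<exists>x y. x \<in> V \<and> y \<in> V \<and> x \<noteq> y \<and> e = {x, y})"

definition graph_iso :: "'a set \<Rightarrow> 'a set set \<Rightarrow> 'b set \<Rightarrow> 'b set set \<Rightarrow> bool" where
  "graph_iso V E V' E' \<longleftrightarrow>
     (\<exists>f. bij_betw f V V' \<and> (\<forall>x\<in>V. \<forall>y\<in>V. {x, y} \<in> E \<longleftrightarrow> {f x, f y} \<in> E'))"

definition P3_V :: "nat set" where "P3_V = {0, 1, 2}"
definition P3_E :: "nat set set" where "P3_E = {{0, 1}, {1, 2}}"
definition C4_V :: "nat set" where "C4_V = {0, 1, 2, 3}"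
definition C4_E :: "nat set set" where "C4_E = {{0, 1}, {1, 2}, {2, 3}, {3, 0}}"

definition dprod_V :: "'a set \<Rightarrow> 'b set \<Rightarrow> ('a \<times> 'b) set" where
  "dprod_V VG VH = VG \<times> VH"

definition dprod_E :: "'a set set \<Rightarrow> 'b set set \<Rightarrow> ('a \<times> 'b) set set" where
  "dprod_E EG EH = {{(x1, y1), (x2, y2)} | x1 x2 y1 y2. {x1, x2} \<in> EG \<and> {y1, y2} \<in> EH}"

definition reachable :: "'a set set \<Rightarrow> 'a \<Rightarrow> 'a \<Rightarrow> bool" where
  "reachable E u v \<longleftrightarrow> (u, v) \<in> {(a, b). {a, b} \<in> E}\<^sup>*"

definition connected_graph :: "'a set \<Rightarrow> 'a set set \<Rightarrow> bool" where
  "connected_graph V E \<longleftrightarrow> (\<forall>u\<in>V. \<forall>v\<in>V. reachable E u v)"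

definition is_edge_cut :: "'a set \<Rightarrow> 'a set set \<Rightarrow> 'a set set \<Rightarrow> bool" where
  "is_edge_cut V E S \<longleftrightarrow> S \<subseteq> E \<and> \<not> connected_graph V (E - S)"

definition is_min_edge_cut :: "'a set \<Rightarrow> 'a set set \<Rightarrow> 'a set set \<Rightarrow> bool" where
  "is_min_edge_cut V E S \<longleftrightarrow> is_edge_cut V E S \<and> (\<forall>S'. is_edge_cut V E S' \<longrightarrow> card S \<le> card S')"

definition is_component :: "'a set \<Rightarrow> 'a set set \<Rightarrow> 'a set \<Rightarrow> bool" where
  "is_component V E C \<longleftrightarrow> (\<exists>v\<in>V. C = {u \<in> V. reachable E v u})"

text \<open>Shapes of the pair (B, W); all partitions are disjoint unions (parts may be empty).\<close>
definition cut_type1 :: "'a set \<Rightarrow> 'b set \<Rightarrow> ('a \<times> 'b) set \<Rightarrow> ('a \<times> 'b) set \<Rightarrow> bool" where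
  "cut_type1 VG VH B W \<longleftrightarrow> (\<exists>B' W'. VG = B' \<union> W' \<and> B' \<inter> W' = {} \<and>
      B = B' \<times> VH \<and> W = W' \<times> VH)"

definition cut_type2 :: "'a set \<Rightarrow> 'b set \<Rightarrow> ('a \<times> 'b) set \<Rightarrow> ('a \<times> 'b) set \<Rightarrow> bool" where
  "cut_type2 VG VH B W \<longleftrightarrow> (\<exists>B' W'. VH = B' \<union> W' \<and> B' \<inter> W' = {} \<and>
      B = VG \<times> B' \<and> W = VG \<times> W')"

definition cut_type3 :: "'a set \<Rightarrow> 'b set \<Rightarrow> ('a \<times> 'b) set \<Rightarrow> ('a \<times> 'b) set \<Rightarrow> bool" where
  "cut_type3 VG VH B W \<longleftrightarrow> card B = 1 \<or> card W = 1"

definition cut_type4 :: "'a set \<Rightarrow> 'b set \<Rightarrow> ('a \<times> 'b) set \<Rightarrow> ('a \<times> 'b) set \<Rightarrow> bool" where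
  "cut_type4 VG VH B W \<longleftrightarrow> (\<exists>X1 X2 Y1 Y2. VG = X1 \<union> X2 \<and> X1 \<inter> X2 = {} \<and>
      VH = Y1 \<union> Y2 \<and> Y1 \<inter> Y2 = {} \<and>
      B = (X1 \<times> Y1) \<union> (X2 \<times> Y2) \<and> W = (X1 \<times> Y2) \<union> (X2 \<times> Y1))"

definition cut_type5 :: "'a set \<Rightarrow> 'b set \<Rightarrow> ('a \<times> 'b) set \<Rightarrow> ('a \<times> 'b) set \<Rightarrow> bool" where
  "cut_type5 VG VH B W \<longleftrightarrow> (\<exists>A1 A2 A3 C D. VG = A1 \<union> A2 \<union> A3 \<and>
      A1 \<inter> A2 = {} \<and> A1 \<inter> A3 = {} \<and> A2 \<inter> A3 = {} \<and>
      VH = C \<union> D \<and> C \<inter> D = {} \<and>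
      B = (A1 \<times> C) \<union> (A2 \<times> D) \<and> W = (A1 \<times> D) \<union> (A2 \<times> C) \<union> (A3 \<times> VH))"

definition cut_type6 :: "'a set \<Rightarrow> 'b set \<Rightarrow> ('a \<times> 'b) set \<Rightarrow> ('a \<times> 'b) set \<Rightarrow> bool" where
  "cut_type6 VG VH B W \<longleftrightarrow> (\<exists>X Y C1 C2 C3. VG = X \<union> Y \<and> X \<inter> Y = {} \<and>
      VH = C1 \<union> C2 \<union> C3 \<and> C1 \<inter> C2 = {} \<and> C1 \<inter> C3 = {} \<and> C2 \<inter> C3 = {} \<and>
      B = (X \<times> C1) \<union> (Y \<times> C2) \<and> W = (X \<times> C2) \<union> (Y \<times> C1) \<union> (VG \<times> C3))"

definition cut_type7 :: "'a set \<Rightarrow> 'b set \<Rightarrow> ('a \<times> 'b) set \<Rightarrow> ('a \<times> 'b) set \<Rightarrow> bool" where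
  "cut_type7 VG VH B W \<longleftrightarrow> (\<exists>A1 A2 A3 A4 C D. VG = A1 \<union> A2 \<union> A3 \<union> A4 \<and>
      A1 \<inter> A2 = {} \<and> A1 \<inter> A3 = {} \<and> A1 \<inter> A4 = {} \<and>
      A2 \<inter> A3 = {} \<and> A2 \<inter> A4 = {} \<and> A3 \<inter> A4 = {} \<and>
      VH = C \<union> D \<and> C \<inter> D = {} \<and>
      B = (A1 \<times> C) \<union> (A2 \<times> D) \<union> (A4 \<times> VH) \<and>
      W = (A1 \<times> D) \<union> (A2 \<times> C) \<union> (A3 \<times> VH))"

definition cut_type8 :: "'a set \<Rightarrow> 'b set \<Rightarrow> ('a \<times> 'b) set \<Rightarrow> ('a \<times> 'b) set \<Rightarrow> bool" where
  "cut_type8 VG VH B W \<longleftrightarrow> (\<exists>X Y C1 C2 C3 C4. VG = X \<union> Y \<and> X \<inter> Y = {} \<and>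
      VH = C1 \<union> C2 \<union> C3 \<union> C4 \<and>
      C1 \<inter> C2 = {} \<and> C1 \<inter> C3 = {} \<and> C1 \<inter> C4 = {} \<and>
      C2 \<inter> C3 = {} \<and> C2 \<inter> C4 = {} \<and> C3 \<inter> C4 = {} \<and>
      B = (X \<times> C1) \<union> (Y \<times> C2) \<union> (VG \<times> C4) \<and>
      W = (X \<times> C2) \<union> (Y \<times> C1) \<union> (VG \<times> C3))"

definition cut_type :: "nat \<Rightarrow> 'a set \<Rightarrow> 'b set \<Rightarrow> ('a \<times> 'b) set \<Rightarrow> ('a \<times> 'b) set \<Rightarrow> bool" where
  "cut_type k VG VH B W \<longleftrightarrow>
     (k = 1 \<and> cut_type1 VG VH B W) \<or> (k = 2 \<and> cut_type2 VG VH B W) \<or>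
     (k = 3 \<and> cut_type3 VG VH B W) \<or> (k = 4 \<and> cut_type4 VG VH B W) \<or>
     (k = 5 \<and> cut_type5 VG VH B W) \<or> (k = 6 \<and> cut_type6 VG VH B W) \<or>
     (k = 7 \<and> cut_type7 VG VH B W) \<or> (k = 8 \<and> cut_type8 VG VH B W)"

end

theory Submission
  imports Defs
begin

text \<open>
  Write \<open>\<delta>\<close> and \<open>\<epsilon>\<close> for the minimum degrees of \<open>G\<close> and \<open>H\<close>. A black set \<open>B\<close> is a family of rows
  \<open>B\<^sub>x \<subseteq> V(H)\<close>, and twice its cut size is the sum over the arcs \<open>(x, x')\<close> of \<open>G\<close> of the cut size of
  the pair \<open>(B\<^sub>x, B\<^sub>x')\<close> in the bipartite double cover of \<open>H\<close>; the same holds for columns. Call a row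
  or column mixed if it is neither empty nor full. Singletons show that a minimum cut has size at most
  \<open>\<delta> \<epsilon>\<close>, and type 7 or 8 is immediate if at most one row or at most one column is mixed. Otherwise:

  If some row and some column are not mixed, then \<open>B\<close> (or its complement) lies in the corner of mixed
  rows and columns. Level sets of the degree sum of a row bound the row sizes by \<open>\<delta>\<close>, so that (for
  \<open>\<delta> \<le> \<epsilon>\<close>) every arc between mixed rows costs at least \<open>\<epsilon>\<close>, which is too much.

  If all rows are mixed and \<open>G\<close> is bipartite, every single arc yields a competing cut, so all arcs have
  equal cost. Modularity makes rows with a common neighbour equal, except when \<open>G\<close> is \<open>P\<^sub>3\<close> or \<open>C\<^sub>4\<close>,
  and then all columns are empty, full, or a colour class of \<open>G\<close>.

  If all rows are mixed and \<open>G\<close> is not bipartite, every arc has positive cost. Counting on both sides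
  produces an arc of \<open>G\<close> of cost one, whose rows differ in at least \<open>2 \<epsilon>\<close> columns; this is more than
  the number of mixed columns, unless all columns are mixed and \<open>H\<close> is bipartite.
\<close>

text \<open>The cut size of \<open>X \<times> {0} \<union> Y \<times> {1}\<close> in the bipartite double cover of \<open>R\<close>. As \<open>R\<close> holds both
  orientations of every edge, \<open>prod_cut\<close> below is twice the number of cut edges.\<close>

definition mismatch :: "('a \<times> 'a) set \<Rightarrow> 'a set \<Rightarrow> 'a set \<Rightarrow> nat" where
  "mismatch R X Y = card {(u, v) \<in> R. (u \<in> X) \<noteq> (v \<in> Y)}"

definition bipartition :: "'a set \<Rightarrow> ('a \<times> 'a) set \<Rightarrow> 'a set \<Rightarrow> bool" where
  "bipartition V R X \<longleftrightarrow> X \<subseteq> V \<and> (\<forall>(u, v) \<in> R. (u \<in> X) \<noteq> (v \<in> X))"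

lemma bipartitionD: "bipartition V R X \<Longrightarrow> (u, v) \<in> R \<Longrightarrow> (u \<in> X) \<noteq> (v \<in> X)"
  unfolding bipartition_def by auto

section \<open>Mismatch bounds in one connected graph\<close>

text \<open>Connectedness is stated as an arc leaving every proper nonempty set, the form in which
  closed sets and level sets use it.\<close>

locale conn_graph =
  fixes V :: "'a set" and R :: "('a \<times> 'a) set" and \<delta> :: nat
  assumes finite_V: "finite V"
    and R_sub: "R \<subseteq> V \<times> V"
    and R_sym: "(u, v) \<in> R \<Longrightarrow> (v, u) \<in> R"
    and R_irrefl: "(u, u) \<notin> R"
    and R_conn: "X \<subseteq> V \<Longrightarrow> X \<noteq> {} \<Longrightarrow> X \<noteq> V \<Longrightarrow> \<exists>(u, v) \<in> R. u \<in> X \<and> v \<notin> X"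
    and degree_ge: "u \<in> V \<Longrightarrow> \<delta> \<le> card (R `` {u})"
    and \<delta>_pos: "1 \<le> \<delta>"
begin

lemma finite_R: "finite R"
  using finite_subset[OF R_sub] finite_V by blast

lemma finite_arcs [simp]: "finite {(u, v) \<in> R. P u v}"
  by (rule finite_subset[OF _ finite_R]) auto

lemma finite_nbrs [simp]: "finite (R `` {u})"
  by (rule finite_subset[OF _ finite_V]) (use R_sub in auto)

lemma finite_sub: "X \<subseteq> V \<Longrightarrow> finite X"
  using finite_V finite_subset by blast

lemma card_swap_arcs: "card {(u, v) \<in> R. P u v} = card {(u, v) \<in> R. P v u}"
proof -
  have "{(u, v) \<in> R. P v u} = prod.swap ` {(u, v) \<in> R. P u v}"
    using R_sym by (auto simp: image_iff)
  then show ?thesis by (simp add: card_image)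
qed

lemma card_arcs_from:
  assumes "X \<subseteq> V"
  shows "card {(u, v) \<in> R. u \<in> X} = (\<Sum>u\<in>X. card (R `` {u}))"
proof -
  have "{(u, v) \<in> R. u \<in> X} = Sigma X (\<lambda>u. R `` {u})" by auto
  then show ?thesis using finite_sub[OF assms] by simp
qed

lemma card_arcs_from_ge:
  assumes "X \<subseteq> V"
  shows "card X * \<delta> \<le> card {(u, v) \<in> R. u \<in> X}"
  unfolding card_arcs_from[OF assms]
  using sum_bounded_below[of X \<delta> "\<lambda>u. card (R `` {u})"] degree_ge assms by auto

lemma card_R_ge: "card V * \<delta> \<le> card R"
proof -
  have "{(u, v) \<in> R. u \<in> V} = R" using R_sub by auto
  then show ?thesis using card_arcs_from_ge[of V] by simp
qed

lemma mismatch_commute: "mismatch R X Y = mismatch R Y X"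
proof -
  have "mismatch R X Y = card {(u, v) \<in> R. (v \<in> X) \<noteq> (u \<in> Y)}"
    unfolding mismatch_def by (rule card_swap_arcs)
  also have "{(u, v) \<in> R. (v \<in> X) \<noteq> (u \<in> Y)} = {(u, v) \<in> R. (u \<in> Y) \<noteq> (v \<in> X)}" by auto
  finally show ?thesis unfolding mismatch_def .
qed

lemma mismatch_compl:
  assumes "X \<subseteq> V" "Y \<subseteq> V"
  shows "mismatch R (V - X) (V - Y) = mismatch R X Y"
proof -
  have "{(u, v) \<in> R. (u \<in> V - X) \<noteq> (v \<in> V - Y)} = {(u, v) \<in> R. (u \<in> X) \<noteq> (v \<in> Y)}"
    using R_sub by auto
  then show ?thesis unfolding mismatch_def by simp
qed

lemma mismatch_zero: "mismatch R X Y = 0 \<longleftrightarrow> (\<forall>(u, v) \<in> R. (u \<in> X) = (v \<in> Y))"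
  unfolding mismatch_def by (subst card_0_eq) auto

text \<open>At most \<open>card Y\<close> neighbours of a vertex of \<open>X\<close> lie in
  \<open>Y\<close>. Truncated subtraction makes the bound trivial once \<open>card Y\<close> exceeds
  \<open>\<delta>\<close>.\<close>

lemma out_mismatch_ge:
  assumes "X \<subseteq> V" "Y \<subseteq> V"
  shows "card X * (\<delta> - card Y) \<le> card {(u, v) \<in> R. u \<in> X \<and> v \<notin> Y}"
proof -
  have "{(u, v) \<in> R. u \<in> X \<and> v \<notin> Y} = Sigma X (\<lambda>u. R `` {u} - Y)" by auto
  then have "card {(u, v) \<in> R. u \<in> X \<and> v \<notin> Y} = (\<Sum>u\<in>X. card (R `` {u} - Y))"
    using finite_sub[OF assms(1)] by simp
  moreover have "\<delta> - card Y \<le> card (R `` {u} - Y)" if "u \<in> X" for u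
  proof -
    have "card (R `` {u}) - card Y \<le> card (R `` {u} - Y)"
      by (rule diff_card_le_card_Diff[OF finite_sub[OF assms(2)]])
    then show ?thesis using degree_ge[of u] that assms(1) by force
  qed
  ultimately show ?thesis
    using sum_bounded_below[of X "\<delta> - card Y" "\<lambda>u. card (R `` {u} - Y)"] by simp
qed

lemma mismatch_split:
  "mismatch R X Y = card {(u, v) \<in> R. u \<in> X \<and> v \<notin> Y} + card {(u, v) \<in> R. u \<in> Y \<and> v \<notin> X}"
proof -
  have "{(u, v) \<in> R. (u \<in> X) \<noteq> (v \<in> Y)}
      = {(u, v) \<in> R. u \<in> X \<and> v \<notin> Y} \<union> {(u, v) \<in> R. v \<in> Y \<and> u \<notin> X}" by auto
  moreover have "card {(u, v) \<in> R. v \<in> Y \<and> u \<notin> X} = card {(u, v) \<in> R. u \<in> Y \<and> v \<notin> X}"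
    by (rule card_swap_arcs)
  moreover have "{(u, v) \<in> R. u \<in> X \<and> v \<notin> Y} \<inter> {(u, v) \<in> R. v \<in> Y \<and> u \<notin> X} = {}" by auto
  ultimately show ?thesis unfolding mismatch_def by (simp add: card_Un_disjoint)
qed

lemma mismatch_ge:
  assumes "X \<subseteq> V" "Y \<subseteq> V"
  shows "card X * (\<delta> - card Y) + card Y * (\<delta> - card X) \<le> mismatch R X Y"
  using out_mismatch_ge[OF assms] out_mismatch_ge[OF assms(2,1)] mismatch_split by simp

text \<open>If \<open>card X < \<delta>\<close>, the bound of \<open>mismatch_ge\<close> is at least
  \<open>\<delta>\<close>: the term with factor \<open>card Y\<close> suffices when
  \<open>card Y \<ge> \<delta>\<close>, and otherwise both terms together do, as one set is
  nonempty.\<close>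

lemma cheap_card_left:
  assumes "X \<subseteq> V" "Y \<subseteq> V" "X \<noteq> {} \<or> Y \<noteq> {}" "mismatch R X Y < \<delta>"
  shows "\<delta> \<le> card X"
proof (rule ccontr)
  assume "\<not> \<delta> \<le> card X"
  then obtain k where k: "\<delta> = card X + Suc k" by (metis add_Suc_right less_imp_Suc_add not_le)
  have m: "card X * (\<delta> - card Y) + card Y * Suc k < \<delta>"
    using mismatch_ge[OF assms(1,2)] assms(4) k by simp
  show False
  proof (cases "\<delta> \<le> card Y")
    case True
    then show False using m by simp
  next
    case False
    then obtain l where l: "\<delta> = card Y + Suc l" by (metis add_Suc_right less_imp_Suc_add not_le)
    have "card X * Suc l + card Y * Suc k < \<delta>" using m l by simp
    moreover have "card X \<noteq> 0 \<or> card Y \<noteq> 0"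
      using assms finite_sub[OF assms(1)] finite_sub[OF assms(2)] by auto
    ultimately show False using k l
      by (cases "card X"; cases "card Y") (auto simp: algebra_simps)
  qed
qed

lemma cheap_card:
  assumes "X \<subseteq> V" "Y \<subseteq> V" "X \<noteq> {} \<or> Y \<noteq> {}" "mismatch R X Y < \<delta>"
  shows "\<delta> \<le> card X" "\<delta> \<le> card Y"
  using cheap_card_left[OF assms] cheap_card_left[of Y X] assms mismatch_commute by auto

text \<open>Complementing both sets preserves the mismatch, so \<open>X\<close> and
  \<open>V - X\<close> both have at least \<open>\<delta>\<close> vertices.\<close>

lemma cheap_card_V:
  assumes "X \<subseteq> V" "Y \<subseteq> V" "X \<noteq> {}" "X \<noteq> V" "mismatch R X Y < \<delta>"
  shows "2 * \<delta> \<le> card V"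
proof -
  have "\<delta> \<le> card X" using cheap_card assms by blast
  moreover have "\<delta> \<le> card (V - X)"
    by (rule cheap_card[of _ "V - Y"]) (use assms mismatch_compl in auto)
  moreover have "card V = card X + card (V - X)"
    using assms(1) finite_V by (metis card_Diff_subset card_mono finite_subset le_add_diff_inverse)
  ultimately show ?thesis by simp
qed

text \<open>Only the arcs meeting \<open>X \<inter> Y\<close> have to be reversed to turn mismatches of \<open>X - Y\<close>, \<open>Y - X\<close> into
  mismatches of \<open>X\<close>, \<open>Y\<close>.\<close>

lemma mismatch_sym_diff_le:
  "mismatch R (X - Y) (Y - X) \<le> mismatch R X Y"
proof -
  define \<phi> where "\<phi> = (\<lambda>(u, v). if u \<in> X \<inter> Y \<or> v \<in> X \<inter> Y then (v, u) else (u, v))"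
  have "inj \<phi>" unfolding \<phi>_def by (rule injI) (auto split: if_splits)
  then have "inj_on \<phi> {(u, v) \<in> R. (u \<in> X - Y) \<noteq> (v \<in> Y - X)}" by (rule inj_on_subset) auto
  moreover have "\<phi> ` {(u, v) \<in> R. (u \<in> X - Y) \<noteq> (v \<in> Y - X)} \<subseteq> {(u, v) \<in> R. (u \<in> X) \<noteq> (v \<in> Y)}"
    unfolding \<phi>_def using R_sym by (auto split: if_splits)
  ultimately show ?thesis unfolding mismatch_def by (rule card_inj_on_le) simp
qed

text \<open>The pair \<open>X - Y\<close>, \<open>Y - X\<close> is no more expensive, so each
  difference has at least \<open>\<delta>\<close> vertices.\<close>

lemma cheap_sym_diff_card:
  assumes "X \<subseteq> V" "Y \<subseteq> V" "X \<noteq> Y" "mismatch R X Y < \<delta>"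
  shows "2 * \<delta> \<le> card ((X - Y) \<union> (Y - X))"
proof -
  have cheap: "mismatch R (X - Y) (Y - X) < \<delta>"
    by (rule le_less_trans[OF mismatch_sym_diff_le assms(4)])
  have sub: "X - Y \<subseteq> V" "Y - X \<subseteq> V" "X - Y \<noteq> {} \<or> Y - X \<noteq> {}" using assms by auto
  have "\<delta> \<le> card (X - Y)" "\<delta> \<le> card (Y - X)"
    using cheap_card[OF sub cheap] by simp_all
  moreover have "card ((X - Y) \<union> (Y - X)) = card (X - Y) + card (Y - X)"
    by (rule card_Un_disjoint) (use assms finite_sub in auto)
  ultimately show ?thesis by simp
qed

lemma swap_closed_card_ge_2:
  assumes "\<And>u v. P u v \<Longrightarrow> P v u" "{(u, v) \<in> R. P u v} \<noteq> {}"
  shows "2 \<le> card {(u, v) \<in> R. P u v}"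
proof -
  obtain u v where uv: "(u, v) \<in> R" "P u v" using assms(2) by auto
  then have "{(u, v), (v, u)} \<subseteq> {(u, v) \<in> R. P u v}" using R_sym assms(1) by auto
  then have le: "card {(u, v), (v, u)} \<le> card {(u, v) \<in> R. P u v}"
    by (rule card_mono[OF finite_arcs])
  have "u \<noteq> v" using uv(1) R_irrefl by metis
  then show ?thesis using le by simp
qed

lemma mismatch_self_ge_2:
  assumes "X \<subseteq> V" "X \<noteq> {}" "X \<noteq> V"
  shows "2 \<le> mismatch R X X"
  unfolding mismatch_def
  by (rule swap_closed_card_ge_2) (use R_conn[OF assms] in auto)

text \<open>The mismatched arcs are those with both ends on the same side of \<open>X\<close>; they
  come in pairs of opposite orientations.\<close>

lemma mismatch_compl_ne_1:
  assumes "X \<subseteq> V"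
  shows "mismatch R X (V - X) \<noteq> 1"
proof
  assume *: "mismatch R X (V - X) = 1"
  have "{(u, v) \<in> R. (u \<in> X) \<noteq> (v \<in> V - X)} = {(u, v) \<in> R. (u \<in> X) = (v \<in> X)}"
    using R_sub by auto
  then have "card {(u, v) \<in> R. (u \<in> X) = (v \<in> X)} = 1" using * unfolding mismatch_def by simp
  moreover from this have "{(u, v) \<in> R. (u \<in> X) = (v \<in> X)} \<noteq> {}" by (metis card.empty zero_neq_one)
  ultimately show False using swap_closed_card_ge_2[of "\<lambda>u v. (u \<in> X) = (v \<in> X)"] by auto
qed

lemma closed_set_eq_V:
  assumes "X \<subseteq> V" "X \<noteq> {}" "\<And>u v. (u, v) \<in> R \<Longrightarrow> u \<in> X \<Longrightarrow> v \<in> X"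
  shows "X = V"
  using R_conn[OF assms(1,2)] assms(3) by blast

text \<open>Zero mismatch makes \<open>X \<inter> Y\<close> and the complement of
  \<open>X \<union> Y\<close> closed under adjacency, so each is empty or everything. If both are
  empty, \<open>X\<close> and \<open>Y\<close> are complementary and every arc crosses.\<close>

lemma mismatch_zero_cases:
  assumes "X \<subseteq> V" "Y \<subseteq> V" "mismatch R X Y = 0"
  shows "X = {} \<and> Y = {} \<or> X = V \<and> Y = V \<or> Y = V - X \<and> bipartition V R X"
proof -
  have m: "(u \<in> X) = (v \<in> Y)" "(v \<in> X) = (u \<in> Y)" if "(u, v) \<in> R" for u v
    using assms(3) that R_sym unfolding mismatch_zero by blast+
  consider "X \<inter> Y \<noteq> {}" | "V - (X \<union> Y) \<noteq> {}" | "X \<inter> Y = {}" "X \<union> Y = V" using assms by blast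
  then show ?thesis
  proof cases
    case 1
    have "X \<inter> Y = V" by (rule closed_set_eq_V) (use 1 assms m in auto)
    then show ?thesis using assms by blast
  next
    case 2
    have "V - (X \<union> Y) = V" by (rule closed_set_eq_V) (use 2 m R_sub in auto)
    then show ?thesis using assms by blast
  next
    case 3
    then have "Y = V - X" by blast
    moreover from this have "bipartition V R X"
      unfolding bipartition_def using assms(1) m R_sub by auto
    ultimately show ?thesis by blast
  qed
qed

text \<open>Against the empty set every arc out of \<open>X\<close> is a mismatch; the full set
  follows by complements.\<close>

lemma mismatch_trivial_ge:
  assumes "X \<subseteq> V" "X \<noteq> {}" "X \<noteq> V" "Y = {} \<or> Y = V"
  shows "\<delta> \<le> mismatch R X Y"
proof -
  have *: "\<delta> \<le> mismatch R Z {}" if Z: "Z \<subseteq> V" "Z \<noteq> {}" for Z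
  proof -
    have "card Z \<ge> 1" using Z finite_sub[of Z] by (simp add: Suc_le_eq card_gt_0_iff)
    then have "\<delta> \<le> card Z * \<delta>" by simp
    also have "\<dots> \<le> mismatch R Z {}" using mismatch_ge[of Z "{}"] Z by simp
    finally show ?thesis .
  qed
  show ?thesis using assms(4)
  proof
    assume "Y = {}" then show ?thesis using * assms by simp
  next
    assume Y: "Y = V"
    have "\<delta> \<le> mismatch R (V - X) {}" using * assms by blast
    then show ?thesis using mismatch_compl[of X V] assms Y by simp
  qed
qed

text \<open>A vertex of \<open>X\<close> has at most k - 1 neighbours inside, where k is the size of
  \<open>X\<close>, and k * (\<delta> - k + 1) exceeds \<delta> for 2 \<le> k < \<delta>.\<close>

lemma small_set_boundary:
  assumes "X \<subseteq> V" "2 \<le> card X" "card X < \<delta>"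
  shows "\<delta> < card {(u, v) \<in> R. u \<in> X \<and> v \<notin> X}"
proof -
  have fX: "finite X" using assms(1) finite_sub by blast
  have "{(u, v) \<in> R. u \<in> X \<and> v \<notin> X} = Sigma X (\<lambda>u. R `` {u} - X)" by auto
  then have eq: "card {(u, v) \<in> R. u \<in> X \<and> v \<notin> X} = (\<Sum>u\<in>X. card (R `` {u} - X))"
    using fX by simp
  obtain s where s: "card X = Suc (Suc s)" using assms(2) by (metis add_2_eq_Suc le_Suc_ex)
  obtain r where r: "\<delta> = Suc (card X + r)" using assms(3) less_imp_Suc_add by blast
  have "r + 2 \<le> card (R `` {u} - X)" if "u \<in> X" for u
  proof -
    have "R `` {u} - X = R `` {u} - (X - {u})" using R_irrefl by auto
    then have "card (R `` {u}) - card (X - {u}) \<le> card (R `` {u} - X)"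
      using diff_card_le_card_Diff[of "X - {u}" "R `` {u}"] fX by simp
    moreover have "card (X - {u}) = Suc s" using s that fX by simp
    moreover have "\<delta> \<le> card (R `` {u})" using degree_ge that assms(1) by blast
    ultimately show ?thesis using r s by simp
  qed
  then have "card X * (r + 2) \<le> card {(u, v) \<in> R. u \<in> X \<and> v \<notin> X}"
    unfolding eq using sum_bounded_below[of X "r + 2"] by simp
  moreover have "\<delta> < card X * (r + 2)" using r s by (simp add: algebra_simps)
  ultimately show ?thesis by simp
qed

text \<open>An arc out of \<open>X\<close> is a mismatch or ends in \<open>Y\<close>; in the latter
  case its reverse starts in \<open>Y\<close>.\<close>

lemma mismatch_ge_degree_diff:
  assumes "X \<subseteq> V" "Y \<subseteq> V"
  shows "card {(u, v) \<in> R. u \<in> X} \<le> mismatch R X Y + card {(u, v) \<in> R. u \<in> Y}"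
proof -
  have "card {(u, v) \<in> R. u \<in> X} \<le> card ({(u, v) \<in> R. (u \<in> X) \<noteq> (v \<in> Y)} \<union> {(u, v) \<in> R. v \<in> Y})"
    by (rule card_mono) auto
  also have "\<dots> \<le> mismatch R X Y + card {(u, v) \<in> R. v \<in> Y}"
    unfolding mismatch_def by (rule card_Un_le)
  also have "card {(u, v) \<in> R. v \<in> Y} = card {(u, v) \<in> R. u \<in> Y}" by (rule card_swap_arcs)
  finally show ?thesis .
qed

lemma mismatch_sum: "mismatch R X Y = (\<Sum>(u, v)\<in>R. of_bool ((u \<in> X) \<noteq> (v \<in> Y)))"
proof -
  have "{(u, v) \<in> R. (u \<in> X) \<noteq> (v \<in> Y)} = R \<inter> {p. (fst p \<in> X) \<noteq> (snd p \<in> Y)}" by auto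
  then show ?thesis unfolding mismatch_def
    by (simp add: case_prod_unfold finite_R)
qed

text \<open>True arc by arc: for a fixed end \<open>v\<close> the cost is affine in the indicator of
  \<open>u\<close>, and indicators are modular.\<close>

lemma mismatch_modular:
  "mismatch R X Z + mismatch R Y Z = mismatch R (X \<inter> Y) Z + mismatch R (X \<union> Y) Z"
  unfolding mismatch_sum sum.distrib[symmetric] by (rule sum.cong) auto

text \<open>The start of an arc out of \<open>X - Y\<close> lies in \<open>X\<close> but not in
  \<open>X \<inter> Y\<close>, so exactly one of the two mismatches counts the arc.\<close>

lemma degree_diff_le_mismatch:
  assumes "X \<subseteq> V"
  shows "card (X - Y) * \<delta> \<le> mismatch R X Z + mismatch R (X \<inter> Y) Z"
proof -
  have "X - Y \<subseteq> V" using assms by auto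
  then have "card (X - Y) * \<delta> \<le> card {(u, v) \<in> R. u \<in> X - Y}" by (rule card_arcs_from_ge)
  also have "\<dots> \<le> card ({(u, v) \<in> R. (u \<in> X) \<noteq> (v \<in> Z)} \<union> {(u, v) \<in> R. (u \<in> X \<inter> Y) \<noteq> (v \<in> Z)})"
    by (rule card_mono) auto
  also have "\<dots> \<le> mismatch R X Z + mismatch R (X \<inter> Y) Z"
    unfolding mismatch_def by (rule card_Un_le)
  finally show ?thesis .
qed

lemma bipartition_compl: "bipartition V R X \<Longrightarrow> bipartition V R (V - X)"
  unfolding bipartition_def using R_sub by auto

lemma bipartition_card_R:
  assumes "bipartition V R X"
  shows "card R = 2 * card {(u, v) \<in> R. u \<in> X}"
proof -
  have "R = {(u, v) \<in> R. u \<in> X} \<union> {(u, v) \<in> R. v \<in> X}"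
    using assms unfolding bipartition_def by auto
  moreover have "{(u, v) \<in> R. u \<in> X} \<inter> {(u, v) \<in> R. v \<in> X} = {}"
    using assms unfolding bipartition_def by auto
  ultimately have "card R = card {(u, v) \<in> R. u \<in> X} + card {(u, v) \<in> R. v \<in> X}"
    by (subst card_Un_disjoint[OF finite_arcs finite_arcs, symmetric]) simp_all
  moreover have "card {(u, v) \<in> R. v \<in> X} = card {(u, v) \<in> R. u \<in> X}" by (rule card_swap_arcs)
  ultimately show ?thesis by simp
qed

lemma card_V_ge: "V \<noteq> {} \<Longrightarrow> \<delta> < card V"
proof -
  assume "V \<noteq> {}"
  then obtain u where u: "u \<in> V" by auto
  have "R `` {u} \<subseteq> V - {u}" using R_sub R_irrefl by auto
  then have "card (R `` {u}) \<le> card (V - {u})" by (rule card_mono[rotated]) (simp add: finite_V)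
  moreover have "card (V - {u}) < card V" by (rule card_Diff1_less[OF finite_V u])
  ultimately show ?thesis using degree_ge[OF u] by simp
qed

lemma nonbipartite_card_V:
  assumes "V \<noteq> {}" "\<not> (\<exists>X. bipartition V R X)"
  shows "3 \<le> card V"
proof (rule ccontr)
  assume "\<not> 3 \<le> card V"
  moreover have "1 < card V" using card_V_ge[OF assms(1)] \<delta>_pos by simp
  ultimately have "card V = 2" by simp
  then obtain a b where ab: "V = {a, b}" "a \<noteq> b" by (auto simp: card_2_iff)
  then have "bipartition V R {a}" unfolding bipartition_def using R_sub R_irrefl by auto
  then show False using assms by blast
qed

end

section \<open>Cuts of the product, counted by rows or by columns\<close>

definition prod_cut :: "('a \<times> 'a) set \<Rightarrow> ('b \<times> 'b) set \<Rightarrow> ('a \<times> 'b) set \<Rightarrow> nat" where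
  "prod_cut R Q B = (\<Sum>(x, x') \<in> R. mismatch Q (B `` {x}) (B `` {x'}))"

lemma prod_cut_card:
  assumes "finite R" "finite Q"
  shows "prod_cut R Q B = card {((x, x'), (y, y')) \<in> R \<times> Q. ((x, y) \<in> B) \<noteq> ((x', y') \<in> B)}"
proof -
  let ?M = "\<lambda>p. {(y, y') \<in> Q. (y \<in> B `` {fst p}) \<noteq> (y' \<in> B `` {snd p})}"
  have eq: "{((x, x'), (y, y')) \<in> R \<times> Q. ((x, y) \<in> B) \<noteq> ((x', y') \<in> B)} = Sigma R ?M" by auto
  have fin: "\<forall>p\<in>R. finite (?M p)"
    by (auto intro: finite_subset[OF _ assms(2)])
  have "card {((x, x'), (y, y')) \<in> R \<times> Q. ((x, y) \<in> B) \<noteq> ((x', y') \<in> B)}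
      = (\<Sum>p\<in>R. card (?M p))"
    unfolding eq by (rule card_SigmaI[OF assms(1) fin])
  then show ?thesis unfolding prod_cut_def mismatch_def by (simp add: case_prod_unfold)
qed

text \<open>The count over pairs of arcs is symmetric in the two factors, so rows may be exchanged
  for columns.\<close>

lemma prod_cut_converse:
  assumes "finite R" "finite Q"
  shows "prod_cut Q R (B\<inverse>) = prod_cut R Q B"
proof -
  have "{((y, y'), (x, x')) \<in> Q \<times> R. ((y, x) \<in> B\<inverse>) \<noteq> ((y', x') \<in> B\<inverse>)}
      = prod.swap ` {((x, x'), (y, y')) \<in> R \<times> Q. ((x, y) \<in> B) \<noteq> ((x', y') \<in> B)}"
    (is "?L = prod.swap ` ?K")
  proof
    show "?L \<subseteq> prod.swap ` ?K"
    proof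
      fix p assume "p \<in> ?L"
      then have "prod.swap p \<in> ?K" by auto
      then show "p \<in> prod.swap ` ?K" using image_eqI[of p prod.swap "prod.swap p"] by simp
    qed
  qed auto
  then show ?thesis
    unfolding prod_cut_card[OF assms] prod_cut_card[OF assms(2,1)] by (simp add: card_image)
qed

definition mixed :: "'a set \<Rightarrow> 'b set \<Rightarrow> ('a \<times> 'b) set \<Rightarrow> 'a set" where
  "mixed V U B = {x \<in> V. B `` {x} \<noteq> {} \<and> B `` {x} \<noteq> U}"

lemma mixed_sub: "mixed V U B \<subseteq> V"
  unfolding mixed_def by auto

lemma card_crossing_le:
  fixes p q L :: nat
  shows "(\<Sum>t<L. of_bool ((p \<le> t) \<noteq> (q \<le> t))) \<le> min (max p q) L - min p q"
proof -
  have "(\<Sum>t<L. of_bool ((p \<le> t) \<noteq> (q \<le> t))) = card ({..<L} \<inter> {t. (p \<le> t) \<noteq> (q \<le> t)})"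
    by simp
  also have "\<dots> \<le> card {min p q..<min (max p q) L}"
    by (rule card_mono) auto
  finally show ?thesis by simp
qed

locale two_graphs =
  G: conn_graph V R \<delta> + H: conn_graph U Q \<epsilon>
  for V :: "'a set" and R and \<delta> and U :: "'b set" and Q and \<epsilon>
begin

lemma swapped: "two_graphs U Q \<epsilon> V R \<delta>"
  by unfold_locales

section \<open>Counting arcs at mixed rows\<close>

text \<open>An arc leaving the mixed rows ends at an empty or full row and costs at least
  \<open>\<epsilon>\<close> by \<open>mismatch_trivial_ge\<close>; the factor 2 accounts for its
  reverse.\<close>

lemma cut_ge:
  assumes "B \<subseteq> V \<times> U"
    and "\<And>x x'. (x, x') \<in> R \<Longrightarrow> x \<in> mixed V U B \<Longrightarrow> x' \<in> mixed V U B \<Longrightarrow>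
           c \<le> mismatch Q (B `` {x}) (B `` {x'})"
  shows "c * card {(x, x') \<in> R. x \<in> mixed V U B \<and> x' \<in> mixed V U B}
       + 2 * \<epsilon> * card {(x, x') \<in> R. x \<in> mixed V U B \<and> x' \<notin> mixed V U B} \<le> prod_cut R Q B"
proof -
  let ?A = "mixed V U B"
  let ?m = "\<lambda>(x, x'). mismatch Q (B `` {x}) (B `` {x'})"
  let ?I = "{(x, x') \<in> R. x \<in> ?A \<and> x' \<in> ?A}"
  let ?D = "{(x, x') \<in> R. x \<in> ?A \<and> x' \<notin> ?A}"
  let ?E = "{(x, x') \<in> R. x' \<in> ?A \<and> x \<notin> ?A}"
  have rows: "B `` {x} \<subseteq> U" for x using assms(1) by auto
  have leave: "\<epsilon> \<le> mismatch Q (B `` {x}) (B `` {x'})" if "x \<in> ?A" "x' \<in> V" "x' \<notin> ?A" for x x'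
    by (rule H.mismatch_trivial_ge) (use that rows in \<open>auto simp: mixed_def\<close>)
  have leave': "\<epsilon> \<le> mismatch Q (B `` {x}) (B `` {x'})" if "x' \<in> ?A" "x \<in> V" "x \<notin> ?A" for x x'
    unfolding H.mismatch_commute[of "B `` {x}"] using leave that by blast
  have "card ?I * c \<le> sum ?m ?I"
    using sum_bounded_below[of ?I c ?m] assms(2) by auto
  moreover have "card ?D * \<epsilon> \<le> sum ?m ?D"
    using sum_bounded_below[of ?D \<epsilon> ?m] leave G.R_sub by auto
  moreover have "card ?E * \<epsilon> \<le> sum ?m ?E"
    using sum_bounded_below[of ?E \<epsilon> ?m] leave' G.R_sub by auto
  moreover have "card ?E = card ?D" by (rule G.card_swap_arcs)
  moreover have "sum ?m (?I \<union> ?D \<union> ?E) = sum ?m ?I + sum ?m ?D + sum ?m ?E"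
  proof -
    have "sum ?m (?I \<union> ?D \<union> ?E) = sum ?m (?I \<union> ?D) + sum ?m ?E"
      by (rule sum.union_disjoint) auto
    moreover have "sum ?m (?I \<union> ?D) = sum ?m ?I + sum ?m ?D"
      by (rule sum.union_disjoint) auto
    ultimately show ?thesis by simp
  qed
  moreover have "sum ?m (?I \<union> ?D \<union> ?E) \<le> sum ?m R"
    by (rule sum_mono2) (auto simp: G.finite_R)
  ultimately show ?thesis unfolding prod_cut_def by (simp add: algebra_simps)
qed

lemma mixed_degree_sum:
  "card (mixed V U B) * \<delta> \<le> card {(x, x') \<in> R. x \<in> mixed V U B \<and> x' \<in> mixed V U B}
     + card {(x, x') \<in> R. x \<in> mixed V U B \<and> x' \<notin> mixed V U B}"
proof -
  let ?A = "mixed V U B"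
  have "{(x, x') \<in> R. x \<in> ?A}
      = {(x, x') \<in> R. x \<in> ?A \<and> x' \<in> ?A} \<union> {(x, x') \<in> R. x \<in> ?A \<and> x' \<notin> ?A}" by auto
  then have "card {(x, x') \<in> R. x \<in> ?A}
      = card {(x, x') \<in> R. x \<in> ?A \<and> x' \<in> ?A} + card {(x, x') \<in> R. x \<in> ?A \<and> x' \<notin> ?A}"
    by (simp only:) (rule card_Un_disjoint; auto)
  then show ?thesis using G.card_arcs_from_ge[OF mixed_sub, of U B] by simp
qed

lemma mixed_boundary_pos:
  assumes "mixed V U B \<noteq> {}" "mixed V U B \<noteq> V"
  shows "1 \<le> card {(x, x') \<in> R. x \<in> mixed V U B \<and> x' \<notin> mixed V U B}"
proof -
  have "{(x, x') \<in> R. x \<in> mixed V U B \<and> x' \<notin> mixed V U B} \<noteq> {}"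
    using G.R_conn[OF mixed_sub assms] by auto
  then show ?thesis by (simp add: Suc_le_eq card_gt_0_iff)
qed

text \<open>A smaller set of mixed rows would have more than \<open>\<delta>\<close> boundary arcs,
  each costing \<open>2 * \<epsilon>\<close> together with its reverse.\<close>

lemma card_mixed_ge:
  assumes "B \<subseteq> V \<times> U" "prod_cut R Q B \<le> 2 * \<delta> * \<epsilon>" "2 \<le> card (mixed V U B)"
  shows "\<delta> \<le> card (mixed V U B)"
proof (rule ccontr)
  assume "\<not> \<delta> \<le> card (mixed V U B)"
  then have "\<delta> < card {(x, x') \<in> R. x \<in> mixed V U B \<and> x' \<notin> mixed V U B}" (is "_ < ?d")
    using G.small_set_boundary[OF mixed_sub assms(3)] by simp
  moreover have "2 * \<epsilon> * ?d \<le> 2 * \<delta> * \<epsilon>"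
    using cut_ge[OF assms(1), of 0] assms(2) by linarith
  ultimately have "2 * \<epsilon> * ?d \<le> 2 * \<epsilon> * \<delta>" "\<delta> < ?d" by (simp_all add: mult_ac)
  then show False using H.\<delta>_pos by simp
qed

section \<open>All rows mixed over a non-bipartite factor\<close>

lemma nonbipartite_impossible:
  assumes B: "B \<subseteq> V \<times> U" and cut: "prod_cut R Q B \<le> 2 * \<delta> * \<epsilon>"
    and V: "V \<noteq> {}" "mixed V U B = V" and card2: "2 \<le> card (mixed U V (B\<inverse>))"
    and nonbip: "\<not> (\<exists>X. bipartition V R X)"
    and nonbip': "mixed U V (B\<inverse>) = U \<Longrightarrow> \<not> (\<exists>X. bipartition U Q X)"
  shows False
proof -
  interpret S: two_graphs U Q \<epsilon> V R \<delta> by (rule swapped)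
  let ?A = "mixed U V (B\<inverse>)"
  define I where "I = card {(y, y') \<in> Q. y \<in> ?A \<and> y' \<in> ?A}"
  define D where "D = card {(y, y') \<in> Q. y \<in> ?A \<and> y' \<notin> ?A}"
  have B': "B\<inverse> \<subseteq> U \<times> V" using B by auto
  have cut': "prod_cut Q R (B\<inverse>) \<le> 2 * \<epsilon> * \<delta>"
    using cut prod_cut_converse[OF G.finite_R H.finite_R] by (simp add: mult_ac)
  have rows: "B `` {x} \<subseteq> U" for x using B by auto
  have cols: "B\<inverse> `` {y} \<subseteq> V" for y using B by auto
  have nontriv: "B `` {x} \<noteq> {}" "B `` {x} \<noteq> U" if "x \<in> V" for x
    using V(2) that unfolding mixed_def by auto
  have n3: "3 \<le> card V" using G.nonbipartite_card_V[OF V(1) nonbip] .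
  have A_ne: "?A \<noteq> {}" using card2 by auto
  have U_ne: "U \<noteq> {}" using A_ne mixed_sub[of U V "B\<inverse>"] by auto
  have A_ge: "\<epsilon> \<le> card ?A" using S.card_mixed_ge[OF B' cut' card2] .
  have A_cardU: "?A = U \<Longrightarrow> 3 \<le> card U \<and> \<epsilon> < card U"
    using H.nonbipartite_card_V[OF U_ne] nonbip' H.card_V_ge[OF U_ne] by blast
  have D_pos: "?A \<noteq> U \<Longrightarrow> 1 \<le> D" unfolding D_def using S.mixed_boundary_pos A_ne by blast
  have deg: "card ?A * \<epsilon> \<le> I + D" unfolding I_def D_def using S.mixed_degree_sum .

  \<comment> \<open>For a mixed column \<open>mismatch_zero_cases\<close> leaves only a bipartition
    of \<open>V\<close>, which \<open>nonbip\<close> excludes.\<close>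
  have col_pos: "1 \<le> mismatch R (B\<inverse> `` {y}) (B\<inverse> `` {y'})" if "y \<in> ?A" for y y'
  proof (rule ccontr)
    assume "\<not> ?thesis"
    then have "mismatch R (B\<inverse> `` {y}) (B\<inverse> `` {y'}) = 0" by simp
    then show False
      using G.mismatch_zero_cases[OF cols cols] that nonbip unfolding mixed_def by blast
  qed
  have "I + 2 * \<delta> * D \<le> 2 * \<epsilon> * \<delta>"
    using S.cut_ge[OF B', of 1] col_pos cut' unfolding I_def D_def by simp
  then have "I + 2 * (\<delta> * D) \<le> 2 * \<delta> * \<epsilon>" by (simp only: mult_ac)
  moreover have "1 * D \<le> \<delta> * D" using G.\<delta>_pos by (rule mult_le_mono1)
  \<comment> \<open>The summand \<open>D\<close> is kept because it makes the bound on
    \<open>card ?A\<close> strict when some column is not mixed.\<close>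
  ultimately have bnd: "card ?A * \<epsilon> + D \<le> 2 * \<delta> * \<epsilon>"
    using deg by linarith
  then have "card ?A * \<epsilon> \<le> 2 * \<delta> * \<epsilon>" by linarith
  then have A_le: "card ?A \<le> 2 * \<delta>" using H.\<delta>_pos unfolding mult_le_cancel2 by linarith
  have A_less: "card ?A < 2 * \<delta>" if "?A \<noteq> U"
  proof -
    have "card ?A * \<epsilon> < 2 * \<delta> * \<epsilon>" using bnd D_pos[OF that] by linarith
    then show ?thesis unfolding mult_less_cancel2 by blast
  qed

  have n_ge: "2 * \<delta> \<le> card V"
  proof (rule ccontr)
    assume n: "\<not> 2 * \<delta> \<le> card V"
    \<comment> \<open>On fewer than \<open>2 * \<delta>\<close> vertices no arc at a mixed column is
      cheap, by \<open>cheap_card_V\<close>. The budget then forces \<open>D = 0\<close>, so all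
      columns are mixed; there are at least three of them, which is again too expensive.\<close>
    have "\<delta> \<le> mismatch R (B\<inverse> `` {y}) (B\<inverse> `` {y'})" if "y \<in> ?A" for y y'
    proof (rule ccontr)
      assume "\<not> ?thesis"
      then show False
        using G.cheap_card_V[OF cols cols, of y y'] that n unfolding mixed_def by simp
    qed
    then have "\<delta> * I + 2 * \<delta> * D \<le> 2 * \<epsilon> * \<delta>"
      using S.cut_ge[OF B', of \<delta>] cut' unfolding I_def D_def by simp
    then have "\<delta> * (I + 2 * D) \<le> \<delta> * (2 * \<epsilon>)" by (simp add: algebra_simps)
    then have le: "I + 2 * D \<le> 2 * \<epsilon>" using G.\<delta>_pos by simp
    moreover have "2 * \<epsilon> \<le> card ?A * \<epsilon>" using card2 by (rule mult_le_mono1)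
    ultimately have "D = 0" using deg by linarith
    then have "?A = U" using D_pos by (cases "?A = U") simp_all
    then have "3 * \<epsilon> \<le> card ?A * \<epsilon>" using A_cardU by (intro mult_le_mono1) simp
    then show False using deg le H.\<delta>_pos \<open>D = 0\<close> by linarith
  qed

  \<comment> \<open>Rows of cost zero are complementary and bipartition \<open>U\<close>.
    Complementary rows make every column mixed, so \<open>nonbip'\<close> applies.\<close>
  have row_pos: "1 \<le> mismatch Q (B `` {x}) (B `` {x'})" if "x \<in> V" "x' \<in> V" for x x'
  proof (rule ccontr)
    assume "\<not> ?thesis"
    then have "mismatch Q (B `` {x}) (B `` {x'}) = 0" by simp
    then have bip: "B `` {x'} = U - B `` {x}" "bipartition U Q (B `` {x})"
      using H.mismatch_zero_cases[OF rows rows] nontriv that by blast+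
    have "U \<subseteq> ?A"
    proof
      fix y assume "y \<in> U"
      then have "(x, y) \<in> B \<longleftrightarrow> (x', y) \<notin> B" using bip(1) rows by auto
      then show "y \<in> ?A" unfolding mixed_def using \<open>y \<in> U\<close> that by auto
    qed
    then have "?A = U" using mixed_sub by (rule subset_antisym[rotated])
    then show False using nonbip' bip(2) by blast
  qed
  have n_le: "card V \<le> 2 * \<epsilon>"
  proof -
    have "card R * 1 \<le> prod_cut R Q B"
      unfolding prod_cut_def using row_pos G.R_sub
      by (intro order_trans[OF _ sum_bounded_below[of R 1]]) auto
    then have "card V * \<delta> \<le> 2 * \<delta> * \<epsilon>" using G.card_R_ge cut by linarith
    then have "\<delta> * card V \<le> \<delta> * (2 * \<epsilon>)" by (simp only: mult_ac)
    then show ?thesis using G.\<delta>_pos by simp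
  qed
  \<comment> \<open>Strictness comes from \<open>\<epsilon> < card U\<close> if all columns are
    mixed, and from \<open>card ?A < 2 * \<delta>\<close> otherwise.\<close>
  have n_gt: "\<epsilon> < card V" 
  proof (cases "?A = U")
    case True
    then show ?thesis using A_cardU[OF True] A_le n_ge by simp
  next
    case False
    then show ?thesis using A_less[OF False] A_ge n_ge by simp
  qed
  \<comment> \<open>If no arc costs one, all cost at least two, and the budget gives
    \<open>card V \<le> \<epsilon>\<close>.\<close>
  have "\<exists>(x, x') \<in> R. mismatch Q (B `` {x}) (B `` {x'}) = 1"
  proof (rule ccontr)
    assume none: "\<not> ?thesis"
    have "2 \<le> mismatch Q (B `` {x}) (B `` {x'})" if "(x, x') \<in> R" for x x'
    proof -
      have "x \<in> V" "x' \<in> V" using that G.R_sub by auto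
      moreover have "mismatch Q (B `` {x}) (B `` {x'}) \<noteq> 1" using none that by blast
      ultimately show ?thesis using row_pos[of x x'] by simp
    qed
    then have "card R * 2 \<le> prod_cut R Q B"
      unfolding prod_cut_def by (intro order_trans[OF _ sum_bounded_below[of R 2]]) auto
    then have "card V * \<delta> \<le> \<delta> * \<epsilon>" using G.card_R_ge cut by linarith
    then have "\<delta> * card V \<le> \<delta> * \<epsilon>" by (simp only: mult_ac)
    then show False using n_gt G.\<delta>_pos by simp
  qed
  then obtain x x' where xx: "(x, x') \<in> R" and one: "mismatch Q (B `` {x}) (B `` {x'}) = 1" by blast
  have xV: "x \<in> V" "x' \<in> V" using xx G.R_sub by auto
  have e2: "1 < \<epsilon>" using n3 n_le by simp
  have ne: "B `` {x} \<noteq> B `` {x'}"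
    using H.mismatch_self_ge_2[OF rows nontriv[OF xV(1)]] one by auto
  let ?T = "(B `` {x} - B `` {x'}) \<union> (B `` {x'} - B `` {x})"
  have T: "2 * \<epsilon> \<le> card ?T"
    using H.cheap_sym_diff_card[OF rows rows ne] one e2 by simp
  have TA: "?T \<subseteq> ?A" using rows xV unfolding mixed_def by auto
  have finA: "finite ?A" by (rule H.finite_sub[OF mixed_sub])
  show False
  proof (cases "?A = U")
    case True
    \<comment> \<open>Rows that differ everywhere are complements, whose mismatch is never one. This
      gives the strictness missing from \<open>card ?A \<le> 2 * \<delta>\<close>.\<close>
    have "?T \<noteq> U"
    proof
      assume "?T = U"
      then have "B `` {x'} = U - B `` {x}" using rows by auto
      then show False using one H.mismatch_compl_ne_1[OF rows] by metis
    qed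
    then have "?T \<subset> ?A" using TA True by blast
    then have "card ?T < card ?A" by (rule psubset_card_mono[OF finA])
    then show False using T n_le n_ge A_le by simp
  next
    case False
    have "card ?T \<le> card ?A" by (rule card_mono[OF finA TA])
    then show False using T n_le n_ge A_less[OF False] by simp
  qed
qed

section \<open>Cuts with an empty row and an empty column\<close>

text \<open>At cost zero the row is full or the two rows are complementary; either way one of them
  meets the empty column of \<open>y0\<close>.\<close>

lemma corner_row_pos:
  assumes B: "B \<subseteq> V \<times> U" and y0: "y0 \<in> U" "B\<inverse> `` {y0} = {}" and x: "B `` {x} \<noteq> {}"
  shows "1 \<le> mismatch Q (B `` {x}) (B `` {x'})"
proof (rule ccontr)
  assume "\<not> ?thesis"
  then have "mismatch Q (B `` {x}) (B `` {x'}) = 0" by simp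
  moreover have "B `` {x} \<subseteq> U" "B `` {x'} \<subseteq> U" using B by auto
  ultimately have "B `` {x} = U \<or> B `` {x'} = U - B `` {x}"
    using H.mismatch_zero_cases x by blast
  moreover have "y0 \<notin> B `` {x}" "y0 \<notin> B `` {x'}" using y0(2) by auto
  ultimately show False using y0(1) by blast
qed

text \<open>Every level set of the degree sum \<open>h\<close> of a row is a cut of \<open>G\<close> separating the row maximising
  \<open>h\<close> from an empty row, and each level it crosses costs an arc at least one.\<close>

lemma corner_cut_ge:
  assumes B: "B \<subseteq> V \<times> U" and x0: "x0 \<in> V" "B `` {x0} = {}" and y0: "y0 \<in> U" "B\<inverse> `` {y0} = {}"
    and x: "x \<in> V" "B `` {x} \<noteq> {}"
  shows "2 * (card (B `` {x}) * \<epsilon> + \<delta>) \<le> prod_cut R Q B + 2"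
proof -
  have rows: "B `` {x} \<subseteq> U" for x using B by auto
  define h where "h x = card {(u, v) \<in> Q. u \<in> B `` {x}}" for x
  define m where "m = (\<lambda>(x, x'). mismatch Q (B `` {x}) (B `` {x'}))"
  have h_row: "card (B `` {x}) * \<epsilon> \<le> h x" for x
    unfolding h_def by (rule H.card_arcs_from_ge[OF rows])
  have h_diff: "h x \<le> m (x, x') + h x'" "h x' \<le> m (x, x') + h x" for x x'
    unfolding h_def m_def
    using H.mismatch_ge_degree_diff[OF rows rows, of x x'] H.mismatch_ge_degree_diff[OF rows rows, of x' x]
    by (simp_all add: H.mismatch_commute)
  have h0: "h x0 = 0" unfolding h_def using x0 by simp
  have "finite (h ` V)" "h ` V \<noteq> {}" using G.finite_V x by auto
  then have "Max (h ` V) \<in> h ` V" by (rule Max_in)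
  then obtain z where z: "z \<in> V" "h z = Max (h ` V)" by auto
  define K where "K = h z"
  have h_le: "h a \<le> K" if "a \<in> V" for a
    unfolding K_def z(2) by (rule Max_ge) (use that G.finite_V in auto)
  have "card (B `` {x}) \<noteq> 0" using x(2) H.finite_sub[OF rows] by auto
  then have "1 * 1 \<le> card (B `` {x}) * \<epsilon>" using H.\<delta>_pos by (intro mult_le_mono) auto
  then have K_pos: "1 \<le> K" using h_row[of x] h_le[OF x(1)] by linarith
  \<comment> \<open>Only levels below \<open>K - 1\<close> are counted. The top level is given up so
    that an arc at \<open>z\<close> has one unit of its cost left for \<open>w\<close>.\<close>
  define L where "L = K - 1"
  have KL: "K = L + 1" using K_pos L_def by simp
  have z_ne: "B `` {z} \<noteq> {}" 
  proof
    assume "B `` {z} = {}"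
    then have "K = 0" unfolding K_def h_def by simp
    then show False using K_pos by simp
  qed
  have m_pos: "1 \<le> m (z, b)" "1 \<le> m (b, z)" for b
    unfolding m_def using corner_row_pos[OF B y0 z_ne] H.mismatch_commute by auto
  define c :: "'a \<times> 'a \<Rightarrow> nat \<Rightarrow> nat"
    where "c e t = of_bool ((h (fst e) \<le> t) \<noteq> (h (snd e) \<le> t))" for e t
  define w :: "'a \<times> 'a \<Rightarrow> nat" where "w e = of_bool (fst e = z \<or> snd e = z)" for e
  have arc: "(\<Sum>t<L. c (a, b) t) + w (a, b) \<le> m (a, b)" if "(a, b) \<in> R" for a b
  proof -
    have le: "h a \<le> K" "h b \<le> K" using that G.R_sub h_le by auto
    define s where "s = (\<Sum>t<L. c (a, b) t)"
    have c: "s \<le> min (max (h a) (h b)) (L) - min (h a) (h b)"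
      unfolding s_def c_def using card_crossing_le[of "h a" "h b" "L"] by simp
    have hd: "h a \<le> m (a, b) + h b" "h b \<le> m (a, b) + h a" using h_diff by blast+
    have c1: "s \<le> h b - h a" "s \<le> L - h a" if "h a \<le> h b" using c that by auto
    have c2: "s \<le> h a - h b" "s \<le> L - h b" if "h b \<le> h a" using c that by auto
    have "s + w (a, b) \<le> m (a, b)"
    proof (cases "a = z \<or> b = z")
      case True
      then have "h a = K \<or> h b = K" "1 \<le> m (a, b)" using K_def m_pos by auto
      \<comment> \<open>If both ends have value \<open>K\<close>, no level is crossed and the
        positive cost pays the extra unit; otherwise the dropped top level pays it.\<close>
      then have "s + 1 \<le> m (a, b)"
      proof (cases "h a \<le> h b")
        case True
        then show ?thesis using c1(2)[OF True] KL le hd \<open>h a = K \<or> h b = K\<close> \<open>1 \<le> m (a, b)\<close> by linarith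
      next
        case False
        then have "h b \<le> h a" by simp
        then show ?thesis using c2(2) KL le hd \<open>h a = K \<or> h b = K\<close> \<open>1 \<le> m (a, b)\<close> by linarith
      qed
      then show ?thesis using True by (simp add: w_def)
    next
      case False
      have "s \<le> m (a, b)" using c1(1) c2(1) hd by (meson le_diff_conv nat_le_linear order_trans)
      then show ?thesis using False by (simp add: w_def)
    qed
    then show ?thesis unfolding s_def .
  qed
  have "(\<Sum>e\<in>R. (\<Sum>t<L. c e t) + w e) \<le> (\<Sum>e\<in>R. m e)"
    by (rule sum_mono) (use arc in \<open>metis surj_pair\<close>)
  then have "(\<Sum>e\<in>R. \<Sum>t<L. c e t) + (\<Sum>e\<in>R. w e) \<le> prod_cut R Q B"
    unfolding prod_cut_def m_def by (simp add: sum.distrib)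
  moreover have "2 * (L) \<le> (\<Sum>e\<in>R. \<Sum>t<L. c e t)"
  proof -
    have "2 \<le> (\<Sum>e\<in>R. c e t)" if "t < L" for t
    proof -
      let ?L = "{a \<in> V. h a \<le> t}"
      have "z \<notin> ?L" using that K_def KL by auto
      then have "?L \<noteq> V" using z(1) by blast
      moreover have "?L \<subseteq> V" "?L \<noteq> {}" using x0(1) h0 by auto
      ultimately have "2 \<le> mismatch R ?L ?L" by (intro G.mismatch_self_ge_2)
      also have "\<dots> = (\<Sum>e\<in>R. c e t)"
        unfolding G.mismatch_sum c_def by (rule sum.cong) (use G.R_sub in auto)
      finally show ?thesis .
    qed
    then have "of_nat (card {..<L}) * 2 \<le> (\<Sum>t<L. \<Sum>e\<in>R. c e t)"
      by (intro sum_bounded_below) auto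
    also have "\<dots> = (\<Sum>e\<in>R. \<Sum>t<L. c e t)" by (rule sum.swap)
    finally show ?thesis by (simp add: mult.commute)
  qed
  moreover have "2 * \<delta> \<le> (\<Sum>e\<in>R. w e)"
  proof -
    have "(\<Sum>e\<in>R. w e) = card (R \<inter> {e. fst e = z \<or> snd e = z})"
      unfolding w_def by (simp add: sum_of_bool_eq[OF G.finite_R G.finite_R] del: of_bool_or_iff)
    also have "R \<inter> {e. fst e = z \<or> snd e = z} = {(u, v) \<in> R. u = z} \<union> {(u, v) \<in> R. v = z}" by auto
    also have "card \<dots> = card {(u, v) \<in> R. u = z} + card {(u, v) \<in> R. v = z}"
      by (rule card_Un_disjoint) (use G.R_irrefl in auto)
    also have "card {(u, v) \<in> R. v = z} = card {(u, v) \<in> R. u = z}" by (rule G.card_swap_arcs)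
    finally show ?thesis using G.card_arcs_from_ge[of "{z}"] z(1) by simp
  qed
  ultimately have "2 * K + 2 * \<delta> \<le> prod_cut R Q B + 2" using KL by simp
  moreover have "card (B `` {x}) * \<epsilon> \<le> K" using h_row[of x] h_le[OF x(1)] by linarith
  ultimately show ?thesis by simp
qed

lemma corner_impossible:
  assumes B: "B \<subseteq> V \<times> U" and cut: "prod_cut R Q B \<le> 2 * \<delta> * \<epsilon>"
    and x0: "x0 \<in> V" "B `` {x0} = {}" and y0: "y0 \<in> U" "B\<inverse> `` {y0} = {}"
    and card2: "2 \<le> card (mixed V U B)" and le: "\<delta> \<le> \<epsilon>"
  shows False
proof -
  let ?A = "mixed V U B"
  define I where "I = card {(x, x') \<in> R. x \<in> ?A \<and> x' \<in> ?A}"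
  define D where "D = card {(x, x') \<in> R. x \<in> ?A \<and> x' \<notin> ?A}"
  have rows: "B `` {x} \<subseteq> U" for x using B by auto
  have x0A: "x0 \<notin> ?A" using x0 unfolding mixed_def by auto
  have A_ne: "?A \<noteq> {}" using card2 by auto
  have D_pos: "1 \<le> D" unfolding D_def by (rule mixed_boundary_pos[OF A_ne]) (use x0A x0 in auto)
  have deg: "card ?A * \<delta> \<le> I + D" unfolding I_def D_def by (rule mixed_degree_sum)
  have deg2: "2 * \<delta> \<le> card ?A * \<delta>" using card2 by (rule mult_le_mono1)
  have A_ne': "x \<in> V \<and> B `` {x} \<noteq> {}" if "x \<in> ?A" for x using that unfolding mixed_def by auto
  have bound: "c * I + 2 * \<epsilon> * D \<le> 2 * \<delta> * \<epsilon>"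
    if "\<And>x x'. x \<in> ?A \<Longrightarrow> x' \<in> ?A \<Longrightarrow> c \<le> mismatch Q (B `` {x}) (B `` {x'})" for c
  proof -
    have "c * I + 2 * \<epsilon> * D \<le> prod_cut R Q B"
      unfolding I_def D_def by (rule cut_ge[OF B that])
    then show ?thesis using cut by linarith
  qed
  \<comment> \<open>Treated apart because \<open>corner_cut_ge\<close> pushes the row sizes strictly
    below \<open>\<delta>\<close> only for \<open>\<delta> \<ge> 2\<close>.\<close>
  have "\<delta> \<noteq> 1"
  proof
    assume d1: "\<delta> = 1"
    have "1 * I + 2 * \<epsilon> * D \<le> 2 * \<delta> * \<epsilon>"
      by (rule bound) (use corner_row_pos[OF B y0] A_ne' in blast)
    then have "I + 2 * \<epsilon> * D \<le> 2 * \<epsilon>" using d1 by simp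
    moreover have "2 * \<epsilon> * 1 \<le> 2 * \<epsilon> * D" using D_pos by (rule mult_le_mono2)
    ultimately have "I = 0" "2 * \<epsilon> * D \<le> 2 * \<epsilon> * 1" by linarith+
    then have "D \<le> 1" using H.\<delta>_pos unfolding mult_le_cancel1 by linarith
    then show False using deg card2 d1 \<open>I = 0\<close> by simp
  qed
  then have d2: "2 \<le> \<delta>" using G.\<delta>_pos by simp
  have small: "card (B `` {x}) < \<delta>" if "x \<in> ?A" for x
  proof -
    have "2 * (card (B `` {x}) * \<epsilon> + \<delta>) \<le> 2 * \<delta> * \<epsilon> + 2"
      using corner_cut_ge[OF B x0 y0, of x] A_ne'[OF that] cut by linarith
    then have "2 * (card (B `` {x}) * \<epsilon>) + 2 * \<delta> \<le> 2 * (\<delta> * \<epsilon>) + 2"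
      by (simp only: distrib_left mult.assoc)
    then have "card (B `` {x}) * \<epsilon> < \<delta> * \<epsilon>" using d2 by linarith
    then show ?thesis unfolding mult_less_cancel2 by blast
  qed
  have "\<epsilon> * I + 2 * \<epsilon> * D \<le> 2 * \<delta> * \<epsilon>"
  proof (rule bound)
    fix x x' assume x: "x \<in> ?A" and x': "x' \<in> ?A"
    show "\<epsilon> \<le> mismatch Q (B `` {x}) (B `` {x'})"
    proof (rule ccontr)
      assume "\<not> ?thesis"
      then have "\<epsilon> \<le> card (B `` {x})"
        using H.cheap_card(1)[OF rows rows, of x x'] A_ne'[OF x] by simp
      then show False using small[OF x] le by simp
    qed
  qed
  then have "\<epsilon> * (I + 2 * D) \<le> \<epsilon> * (2 * \<delta>)" by (simp add: algebra_simps)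
  then have "I + 2 * D \<le> 2 * \<delta>" using H.\<delta>_pos unfolding mult_le_cancel1 by linarith
  then show False using deg deg2 D_pos by linarith
qed

section \<open>All rows mixed over a bipartite factor\<close>

text \<open>Every arc joins the two classes and so has the same cost. These sets are the competitors
  against a minimum cut.\<close>

lemma two_rows_cut:
  assumes "bipartition V R X"
  shows "prod_cut R Q (X \<times> P \<union> (V - X) \<times> P') = card R * mismatch Q P P'"
proof -
  let ?C = "X \<times> P \<union> (V - X) \<times> P'"
  have "mismatch Q (?C `` {x}) (?C `` {x'}) = mismatch Q P P'" if "(x, x') \<in> R" for x x'
  proof -
    have V: "x \<in> V" "x' \<in> V" using that G.R_sub by auto
    have "(x \<in> X) \<noteq> (x' \<in> X)" using assms that unfolding bipartition_def by auto
    then consider "x \<in> X" "x' \<notin> X" | "x \<notin> X" "x' \<in> X" by blast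
    then show ?thesis
    proof cases
      case 1
      then have "?C `` {x} = P" "?C `` {x'} = P'" using V by auto
      then show ?thesis by simp
    next
      case 2
      then have "?C `` {x} = P'" "?C `` {x'} = P" using V by auto
      then show ?thesis by (simp add: H.mismatch_commute)
    qed
  qed
  then have "prod_cut R Q ?C = (\<Sum>e\<in>R. mismatch Q P P')"
    unfolding prod_cut_def by (intro sum.cong) auto
  then show ?thesis by simp
qed

end

text \<open>The graphs \<open>P\<^sub>3 = K\<^sub>2\<^sub>,\<^sub>1\<close> and \<open>C\<^sub>4 = K\<^sub>2\<^sub>,\<^sub>2\<close>.\<close>

definition small_biclique :: "'a set \<Rightarrow> ('a \<times> 'a) set \<Rightarrow> bool" where
  "small_biclique V R \<longleftrightarrow> (\<exists>X Y. V = X \<union> Y \<and> X \<inter> Y = {} \<and> card X = 2 \<and> card Y \<in> {1, 2} \<and>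
     R = X \<times> Y \<union> Y \<times> X)"

text \<open>\<open>B_cut_le\<close> will come from cutting off a product vertex of minimum degree,
  the 2 counting orientations. The competitors in \<open>B_min\<close> are arbitrary proper nonempty
  sets, since the boundary of each is an edge cut.\<close>

locale min_prod_cut = two_graphs V R \<delta> U Q \<epsilon>
  for V :: "'a set" and R and \<delta> and U :: "'b set" and Q and \<epsilon> +
  fixes B :: "('a \<times> 'b) set"
  assumes B_sub: "B \<subseteq> V \<times> U"
    and B_cut_le: "prod_cut R Q B \<le> 2 * \<delta> * \<epsilon>"
    and B_min: "C \<subseteq> V \<times> U \<Longrightarrow> C \<noteq> {} \<Longrightarrow> C \<noteq> V \<times> U \<Longrightarrow> prod_cut R Q B \<le> prod_cut R Q C"
    and not_biclique: "\<not> small_biclique V R" "\<not> small_biclique U Q"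
begin

lemma rows_sub: "B `` {x} \<subseteq> U"
  using B_sub by auto

lemma converse_min_prod_cut: "min_prod_cut U Q \<epsilon> V R \<delta> (B\<inverse>)"
proof -
  interpret S: two_graphs U Q \<epsilon> V R \<delta> by (rule swapped)
  have conv: "prod_cut Q R (C\<inverse>) = prod_cut R Q C" for C
    by (rule prod_cut_converse[OF G.finite_R H.finite_R])
  show ?thesis
  proof
    show "B\<inverse> \<subseteq> U \<times> V" using B_sub by auto
    show "prod_cut Q R (B\<inverse>) \<le> 2 * \<epsilon> * \<delta>" using B_cut_le unfolding conv by (simp add: mult_ac)
    show "\<not> small_biclique U Q" "\<not> small_biclique V R" using not_biclique by auto
    fix C assume C: "C \<subseteq> U \<times> V" "C \<noteq> {}" "C \<noteq> U \<times> V"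
    have "C\<inverse> \<noteq> V \<times> U"
    proof
      assume "C\<inverse> = V \<times> U"
      then have "C = U \<times> V" by (metis converse_converse converse_Times)
      then show False using C(3) by simp
    qed
    then have "prod_cut R Q B \<le> prod_cut R Q (C\<inverse>)" using C(1,2) by (intro B_min) auto
    then show "prod_cut Q R (B\<inverse>) \<le> prod_cut Q R C" using conv[of B] conv[of "C\<inverse>"] by simp
  qed
qed

context
  assumes full: "mixed V U B = V" and V_ne: "V \<noteq> {}"
begin

lemma nontrivial_row: "x \<in> V \<Longrightarrow> B `` {x} \<noteq> {}" "x \<in> V \<Longrightarrow> B `` {x} \<noteq> U"
  using full unfolding mixed_def by auto

text \<open>Using \<open>P'\<close> as the row of \<open>x\<close> makes the competitor nonempty and
  proper. \<open>P\<close> may be empty or full, so that intersections and unions of rows can be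
  inserted for it.\<close>

lemma cut_le_two_rows:
  assumes X: "bipartition V R X" and P: "P \<subseteq> U" "P' \<subseteq> U" "P' \<noteq> {}" "P' \<noteq> U" and x: "x \<in> V - X"
  shows "prod_cut R Q B \<le> card R * mismatch Q P P'"
proof -
  obtain y y' where "y \<in> P'" "y' \<in> U - P'" using P by blast
  then have "(x, y) \<in> X \<times> P \<union> (V - X) \<times> P'" "(x, y') \<notin> X \<times> P \<union> (V - X) \<times> P'" "(x, y') \<in> V \<times> U"
    using x by auto
  moreover have "X \<times> P \<union> (V - X) \<times> P' \<subseteq> V \<times> U" using X P unfolding bipartition_def by auto
  ultimately have "prod_cut R Q B \<le> prod_cut R Q (X \<times> P \<union> (V - X) \<times> P')"
    by (intro B_min) blast+
  then show ?thesis using two_rows_cut[OF X] by simp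
qed

text \<open>The rows of any arc yield a two-row competitor, so \<open>card R\<close> times the cost
  of the arc is at least the total. On average it equals the total, hence it does so for every
  arc.\<close>

lemma arc_cost_eq:
  assumes X: "bipartition V R X" and xx': "(x, x') \<in> R"
  shows "card R * mismatch Q (B `` {x}) (B `` {x'}) = prod_cut R Q B"
proof -
  let ?m = "\<lambda>e. mismatch Q (B `` {fst e}) (B `` {snd e})"
  have le: "prod_cut R Q B \<le> card R * ?m e" if "e \<in> R" for e
  proof -
    obtain a b where e: "e = (a, b)" by fastforce
    have ab: "(a, b) \<in> R" "a \<in> V" "b \<in> V" using that e G.R_sub by auto
    then have "(a \<in> X) \<noteq> (b \<in> X)" using X unfolding bipartition_def by auto
    then have "b \<in> V - X \<or> b \<in> V - (V - X)" using ab by auto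
    then show ?thesis
      using cut_le_two_rows[OF X rows_sub rows_sub nontrivial_row[OF ab(3)]]
        cut_le_two_rows[OF G.bipartition_compl[OF X] rows_sub rows_sub nontrivial_row[OF ab(3)]]
      unfolding e by auto
  qed
  have "(\<Sum>e\<in>R. prod_cut R Q B) = (\<Sum>e\<in>R. card R * ?m e)"
    unfolding sum_distrib_left[symmetric] unfolding prod_cut_def by (simp add: case_prod_unfold)
  then have "prod_cut R Q B = card R * ?m (x, x')"
    by (rule sum_mono_inv[OF _ le xx' G.finite_R])
  then show ?thesis by simp
qed

text \<open>By modularity, replacing the row of \<open>a\<close> by its intersection with the row of \<open>b\<close> again gives a
  minimum cut; the vertices in which the two rows differ then force \<open>G\<close> to have very few edges.\<close>

lemma row_sub_of_common_neighbour:
  assumes X: "bipartition V R X" and ab: "a \<in> X" "b \<in> X" "(a, c) \<in> R" "(b, c) \<in> R"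
  shows "B `` {a} \<subseteq> B `` {b}"
proof (rule ccontr)
  assume ns: "\<not> B `` {a} \<subseteq> B `` {b}"
  let ?P = "B `` {a}" and ?P' = "B `` {b}" and ?Q = "B `` {c}"
  let ?F = "prod_cut R Q B"
  have cV: "c \<in> V" using ab G.R_sub by auto
  have cX: "c \<in> V - X" using X ab cV unfolding bipartition_def by auto
  \<comment> \<open>Both competitors cost at least the minimum, and by modularity they sum to twice
    the minimum, so both attain it.\<close>
  have "?F \<le> card R * mismatch Q (?P \<inter> ?P') ?Q" "?F \<le> card R * mismatch Q (?P \<union> ?P') ?Q"
    by (rule cut_le_two_rows[OF X _ rows_sub nontrivial_row[OF cV] cX]; use rows_sub in blast)+
  moreover have "card R * mismatch Q ?P ?Q = ?F" "card R * mismatch Q ?P' ?Q = ?F"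
    using arc_cost_eq[OF X] ab by auto
  moreover have "card R * mismatch Q ?P ?Q + card R * mismatch Q ?P' ?Q
      = card R * mismatch Q (?P \<inter> ?P') ?Q + card R * mismatch Q (?P \<union> ?P') ?Q"
    unfolding distrib_left[symmetric] by (rule arg_cong[OF H.mismatch_modular])
  ultimately have eq: "card R * mismatch Q ?P ?Q = ?F" "card R * mismatch Q (?P \<inter> ?P') ?Q = ?F"
    by linarith+
  have "card (?P - ?P') \<noteq> 0" using ns finite_subset[OF rows_sub H.finite_V] by auto
  \<comment> \<open>A column in which the rows differ makes the two mismatches sum to at least
    \<open>\<epsilon>\<close>; \<open>card R\<close> times that sum is twice the minimum.\<close>
  then have "1 * \<epsilon> \<le> card (?P - ?P') * \<epsilon>" by (intro mult_le_mono1) simp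
  also have "\<dots> \<le> mismatch Q ?P ?Q + mismatch Q (?P \<inter> ?P') ?Q"
    by (rule H.degree_diff_le_mismatch[OF rows_sub])
  finally have "card R * \<epsilon> \<le> card R * (mismatch Q ?P ?Q + mismatch Q (?P \<inter> ?P') ?Q)" by simp
  also have "\<dots> = 2 * ?F" unfolding distrib_left eq by simp
  also have "\<dots> \<le> 4 * \<delta> * \<epsilon>" using B_cut_le by linarith
  finally have R_le: "card R \<le> 4 * \<delta>" using H.\<delta>_pos unfolding mult_le_cancel2 by linarith
  have XV: "X \<subseteq> V" using X unfolding bipartition_def by auto
  have part_le: "card Z \<le> 2" if Z: "bipartition V R Z" for Z
  proof -
    have "Z \<subseteq> V" using Z unfolding bipartition_def by auto
    then have "2 * (card Z * \<delta>) \<le> card R"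
      using G.card_arcs_from_ge G.bipartition_card_R[OF Z] by simp
    then have "card Z * \<delta> \<le> 2 * \<delta>" using R_le by linarith
    then show ?thesis using G.\<delta>_pos unfolding mult_le_cancel2 by linarith
  qed
  let ?Y = "V - X"
  have Yb: "bipartition V R ?Y" using G.bipartition_compl[OF X] .
  have fin: "finite X" "finite ?Y" using XV G.finite_V finite_subset by auto
  have "a \<noteq> b" using ns by auto
  have "{a, b} \<subseteq> X" using ab by auto
  then have "card {a, b} \<le> card X" using fin(1) card_mono by blast
  then have cX2: "card X = 2" using \<open>a \<noteq> b\<close> part_le[OF X] by simp
  have "X = {a, b}"
    using card_subset_eq[OF fin(1) \<open>{a, b} \<subseteq> X\<close>] cX2 \<open>a \<noteq> b\<close> by simp
  have "card ?Y \<noteq> 0" using cX fin(2) by auto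
  then have cY: "card ?Y \<in> {1, 2}" using part_le[OF Yb] by auto
  have nbr: "R `` {y} \<subseteq> X" if "y \<in> ?Y" for y
    using Yb that G.R_sub unfolding bipartition_def by auto
  have "R `` {y} = X" if y: "y \<in> ?Y" for y
  proof (cases "y = c")
    case True
    then have "X \<subseteq> R `` {y}" using \<open>X = {a, b}\<close> ab G.R_sym by auto
    then show ?thesis using nbr[OF y] by blast
  next
    case False
    \<comment> \<open>A vertex \<open>y\<close> besides \<open>c\<close> gives
      \<open>2 * (\<delta> + 2) \<le> card R \<le> 4 * \<delta>\<close>, hence
      \<open>\<delta> \<ge> 2\<close>, and \<open>y\<close> is joined to all of
      \<open>X\<close>.\<close>
    have "{(u, v) \<in> R. u \<in> {y, c}} \<subseteq> {(u, v) \<in> R. u \<in> ?Y}" using y cX by auto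
    then have "card {(u, v) \<in> R. u \<in> {y, c}} \<le> card {(u, v) \<in> R. u \<in> ?Y}"
      by (intro card_mono) auto
    moreover have "card {(u, v) \<in> R. u \<in> {y, c}} = card (R `` {y}) + card (R `` {c})"
      using G.card_arcs_from[of "{y, c}"] y cV False by simp
    moreover have "card (R `` {c}) \<ge> 2"
    proof -
      have "{a, b} \<subseteq> R `` {c}" using ab G.R_sym by auto
      then have "card {a, b} \<le> card (R `` {c})" by (intro card_mono) auto
      then show ?thesis using \<open>a \<noteq> b\<close> by simp
    qed
    moreover have dy: "\<delta> \<le> card (R `` {y})" using G.degree_ge y by blast
    ultimately have "\<delta> + 2 \<le> card {(u, v) \<in> R. u \<in> ?Y}" by simp
    then have "2 * (\<delta> + 2) \<le> card R" unfolding G.bipartition_card_R[OF Yb] by simp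
    then have "2 \<le> \<delta>" using R_le by simp
    then have "card X \<le> card (R `` {y})" using dy cX2 by linarith
    then show ?thesis using card_seteq[OF fin(1) nbr[OF y]] by simp
  qed
  then have YX: "(y, x) \<in> R" if "y \<in> ?Y" "x \<in> X" for x y using that by blast
  have "R = X \<times> ?Y \<union> ?Y \<times> X"
  proof
    show "R \<subseteq> X \<times> ?Y \<union> ?Y \<times> X" using X G.R_sub unfolding bipartition_def by auto
    show "X \<times> ?Y \<union> ?Y \<times> X \<subseteq> R" using YX G.R_sym by auto
  qed
  moreover have "V = X \<union> ?Y" "X \<inter> ?Y = {}" using XV by auto
  ultimately have "small_biclique V R" unfolding small_biclique_def using cX2 cY by blast
  then show False using not_biclique by blast
qed

text \<open>Vertices with a common neighbour have equal rows, so rows alternate between two sets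
  along every walk. A column is determined by which of the two sets contain it.\<close>

lemma bipartite_columns:
  assumes X: "bipartition V R X"
  shows "\<forall>y\<in>U. B\<inverse> `` {y} \<in> {{}, V, X, V - X}"
proof -
  have XV: "X \<subseteq> V" using X unfolding bipartition_def by auto
  have common: "B `` {a} = B `` {b}" if "(a, c) \<in> R" "(b, c) \<in> R" for a b c
  proof -
    have V: "a \<in> V" "b \<in> V" using that G.R_sub by auto
    have "(a \<in> X) = (b \<in> X)" using bipartitionD[OF X that(1)] bipartitionD[OF X that(2)] by blast
    then have "(a \<in> X \<and> b \<in> X) \<or> (a \<in> V - X \<and> b \<in> V - X)" using V by blast
    then show ?thesis
      using row_sub_of_common_neighbour[OF X] row_sub_of_common_neighbour[OF G.bipartition_compl[OF X]] that
      by blast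
  qed
  obtain a0 where "a0 \<in> V" using V_ne by auto
  then have "card (R `` {a0}) \<noteq> 0" using G.degree_ge[of a0] G.\<delta>_pos by linarith
  then have "R `` {a0} \<noteq> {}" by (metis card.empty)
  then obtain b0 where "(a0, b0) \<in> R" by auto
  then obtain a b where ab: "(a, b) \<in> R" "a \<in> X" "b \<notin> X"
    using X G.R_sym unfolding bipartition_def by blast
  let ?P = "B `` {a}" and ?P' = "B `` {b}"
  \<comment> \<open>Recording the rows of all neighbours as well makes \<open>K\<close> closed under
    adjacency.\<close>
  define K where "K = {x \<in> X. B `` {x} = ?P \<and> (\<forall>x'. (x, x') \<in> R \<longrightarrow> B `` {x'} = ?P')}
    \<union> {x \<in> V - X. B `` {x} = ?P' \<and> (\<forall>x'. (x, x') \<in> R \<longrightarrow> B `` {x'} = ?P)}"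
  have "K = V"
  proof (rule G.closed_set_eq_V)
    show "K \<subseteq> V" unfolding K_def using XV by auto
    have "a \<in> K" unfolding K_def using ab common G.R_sym by blast
    then show "K \<noteq> {}" by auto
    fix u v assume uv: "(u, v) \<in> R" "u \<in> K"
    have side: "(u \<in> X) \<noteq> (v \<in> X)" "v \<in> V" using X uv(1) G.R_sub unfolding bipartition_def by auto
    have nb: "B `` {x'} = B `` {u}" if "(v, x') \<in> R" for x'
      using common[OF G.R_sym[OF that] uv(1)] .
    show "v \<in> K" using uv side nb unfolding K_def by auto
  qed
  then have rows: "B `` {x} = (if x \<in> X then ?P else ?P')" if "x \<in> V" for x
    using that unfolding K_def by auto
  show ?thesis
  proof
    fix y assume "y \<in> U"
    have "B\<inverse> `` {y} = {x \<in> V. y \<in> B `` {x}}" using B_sub by auto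
    also have "\<dots> = {x \<in> V. y \<in> (if x \<in> X then ?P else ?P')}" using rows by blast
    also have "\<dots> \<in> {{}, V, X, V - X}"
      using XV by (cases "y \<in> ?P"; cases "y \<in> ?P'") auto
    finally show "B\<inverse> `` {y} \<in> {{}, V, X, V - X}" .
  qed
qed

end

section \<open>Alignment of the rows or of the columns\<close>

lemma full_rows_cases:
  assumes "mixed V U B = V" "V \<noteq> {}" "2 \<le> card (mixed U V (B\<inverse>))"
  shows "(\<exists>X\<subseteq>V. \<forall>y\<in>U. B\<inverse> `` {y} \<in> {{}, V, X, V - X}) \<or>
    mixed U V (B\<inverse>) = U \<and> (\<exists>X. bipartition U Q X)"
proof (cases "\<exists>X. bipartition V R X")
  case True
  then obtain X where X: "bipartition V R X" by blast
  then have "X \<subseteq> V" unfolding bipartition_def by blast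
  then show ?thesis using bipartite_columns[OF assms(1,2) X] by blast
next
  case False
  then show ?thesis
    using nonbipartite_impossible[OF B_sub B_cut_le assms(2,1,3) False] by blast
qed

text \<open>Swapping the factors arranges \<open>\<delta> \<le> \<epsilon>\<close>, and
  complementing arranges that the row which is not mixed is empty. An empty row forces a column that
  is not mixed to be empty too.\<close>

lemma corner_case_impossible:
  assumes V: "mixed V U B \<noteq> V" "2 \<le> card (mixed V U B)"
    and U: "mixed U V (B\<inverse>) \<noteq> U" "2 \<le> card (mixed U V (B\<inverse>))"
  shows False
proof -
  interpret S: two_graphs U Q \<epsilon> V R \<delta> by (rule swapped)
  have main: False
    if C: "C \<subseteq> V \<times> U" "prod_cut R Q C \<le> 2 * \<delta> * \<epsilon>" "mixed V U C = mixed V U B"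
      "mixed U V (C\<inverse>) = mixed U V (B\<inverse>)" and x0: "x0 \<in> V" "C `` {x0} = {}" for C x0
  proof -
    obtain y0 where y0: "y0 \<in> U" "y0 \<notin> mixed U V (C\<inverse>)"
      using U(1) C(4) mixed_sub[of U V "B\<inverse>"] by blast
    have "x0 \<notin> C\<inverse> `` {y0}" using x0(2) by auto
    then have y0': "C\<inverse> `` {y0} = {}" using y0 x0(1) unfolding mixed_def by blast
    show False
    proof (cases "\<delta> \<le> \<epsilon>")
      case True
      show False
        by (rule corner_impossible[OF C(1,2) x0 y0(1) y0' _ True]) (simp add: C(3) V(2))
    next
      case False
      have "C\<inverse> \<subseteq> U \<times> V" using C(1) by auto
      moreover have "prod_cut Q R (C\<inverse>) \<le> 2 * \<epsilon> * \<delta>"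
        using C(2) prod_cut_converse[OF G.finite_R H.finite_R, of C] by (simp add: mult_ac)
      moreover have "(C\<inverse>)\<inverse> `` {x0} = {}" using x0(2) by simp
      moreover have "2 \<le> card (mixed U V (C\<inverse>))" using C(4) U(2) by simp
      ultimately show False
        using S.corner_impossible[of "C\<inverse>" y0 x0] y0(1) y0' x0(1) False by simp
    qed
  qed
  obtain x0 where x0: "x0 \<in> V" "x0 \<notin> mixed V U B" using V(1) mixed_sub[of V U B] by blast
  show False
  proof (cases "B `` {x0} = {}")
    case True
    then show False using main[OF B_sub B_cut_le refl refl x0(1)] by blast
  next
    case False
    let ?C = "V \<times> U - B"
    have cols_sub: "B\<inverse> `` {y} \<subseteq> V" for y using B_sub by auto
    have row: "?C `` {x} = U - B `` {x}" if "x \<in> V" for x using that by auto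
    have col: "?C\<inverse> `` {y} = V - B\<inverse> `` {y}" if "y \<in> U" for y using that by auto
    have x0': "?C `` {x0} = {}" using x0 False row[OF x0(1)] unfolding mixed_def by blast
    have "mismatch Q (?C `` {x}) (?C `` {x'}) = mismatch Q (B `` {x}) (B `` {x'})" if "(x, x') \<in> R" for x x'
    proof -
      have "x \<in> V" "x' \<in> V" using that G.R_sub by auto
      then show ?thesis by (simp add: row H.mismatch_compl rows_sub)
    qed
    then have "prod_cut R Q ?C = prod_cut R Q B"
      unfolding prod_cut_def by (intro sum.cong) auto
    then have "prod_cut R Q ?C \<le> 2 * \<delta> * \<epsilon>" using B_cut_le by simp
    moreover have "mixed V U ?C = mixed V U B"
    proof -
      have "(U - P \<noteq> {} \<and> U - P \<noteq> U) \<longleftrightarrow> (P \<noteq> {} \<and> P \<noteq> U)" if "P \<subseteq> U" for P using that by blast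
      then show ?thesis unfolding mixed_def using row rows_sub by (intro Collect_cong) metis
    qed
    moreover have "mixed U V (?C\<inverse>) = mixed U V (B\<inverse>)"
    proof -
      have "(V - P \<noteq> {} \<and> V - P \<noteq> V) \<longleftrightarrow> (P \<noteq> {} \<and> P \<noteq> V)" if "P \<subseteq> V" for P using that by blast
      then show ?thesis unfolding mixed_def using col cols_sub by (intro Collect_cong) metis
    qed
    ultimately show False using main[of ?C x0] x0(1) x0' by blast
  qed
qed

end

text \<open>The row form of type 7: all mixed rows share one split of \<open>U\<close>. For the
  converse relation it is type 8.\<close>

definition aligned :: "'a set \<Rightarrow> 'b set \<Rightarrow> ('a \<times> 'b) set \<Rightarrow> bool" where
  "aligned V U B \<longleftrightarrow> (\<exists>C\<subseteq>U. \<forall>x\<in>V. B `` {x} \<in> {{}, U, C, U - C})"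

lemma aligned_if_few_mixed:
  assumes "B \<subseteq> V \<times> U" "finite V" "card (mixed V U B) \<le> 1"
  shows "aligned V U B"
proof -
  have "finite (mixed V U B)" by (rule finite_subset[OF mixed_sub assms(2)])
  then have "\<forall>a\<in>mixed V U B. \<forall>b\<in>mixed V U B. a = b"
    using assms(3) card_le_Suc0_iff_eq[of "mixed V U B"] by simp
  \<comment> \<open>If no row is mixed, \<open>x0\<close> is arbitrary; its row is still a subset of
    \<open>U\<close>.\<close>
  then obtain x0 where x0: "mixed V U B \<subseteq> {x0}" by blast
  have "B `` {x} \<in> {{}, U, B `` {x0}, U - B `` {x0}}" if "x \<in> V" for x
  proof (cases "x \<in> mixed V U B")
    case True
    then have "x = x0" using x0 by auto
    then show ?thesis by blast
  next
    case False
    then show ?thesis using that unfolding mixed_def by blast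
  qed
  moreover have "B `` {x0} \<subseteq> U" using assms(1) by auto
  ultimately show ?thesis unfolding aligned_def by blast
qed

text \<open>If all rows are mixed, the columns are aligned unless all columns are mixed and the
  second factor is bipartite; in that case \<open>bipartite_columns\<close> for the converse aligns
  the rows. All columns mixed is the symmetric case.\<close>

theorem (in min_prod_cut) aligned_or_converse_aligned:
  assumes "V \<noteq> {}" "U \<noteq> {}"
  shows "aligned V U B \<or> aligned U V (B\<inverse>)"
proof (cases "card (mixed V U B) \<le> 1 \<or> card (mixed U V (B\<inverse>)) \<le> 1")
  case True
  have "B\<inverse> \<subseteq> U \<times> V" using B_sub by auto
  then show ?thesis
    using True aligned_if_few_mixed[OF B_sub G.finite_V] aligned_if_few_mixed[OF _ H.finite_V] by blast
next
  case False
  then have two: "2 \<le> card (mixed V U B)" "2 \<le> card (mixed U V (B\<inverse>))" by simp_all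
  interpret S: min_prod_cut U Q \<epsilon> V R \<delta> "B\<inverse>" by (rule converse_min_prod_cut)
  have two': "2 \<le> card (mixed V U ((B\<inverse>)\<inverse>))" using two(1) by simp
  consider "mixed V U B = V" | "mixed U V (B\<inverse>) = U"
    using corner_case_impossible[OF _ two(1) _ two(2)] by blast
  then show ?thesis
  proof cases
    case 1
    have "aligned U V (B\<inverse>) \<or> mixed U V (B\<inverse>) = U \<and> (\<exists>X. bipartition U Q X)"
      using full_rows_cases[OF 1 assms(1) two(2)] unfolding aligned_def .
    then show ?thesis
    proof (elim disjE conjE exE)
      fix X assume "mixed U V (B\<inverse>) = U" and X: "bipartition U Q X"
      then have "\<forall>x\<in>V. B `` {x} \<in> {{}, U, X, U - X}"
        using S.bipartite_columns[OF _ assms(2) X] by simp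
      then show ?thesis using X unfolding bipartition_def aligned_def by blast
    qed blast
  next
    case 2
    have "aligned V U B \<or> mixed V U B = V \<and> (\<exists>X. bipartition V R X)"
      using S.full_rows_cases[OF 2 assms(2) two'] unfolding aligned_def converse_converse .
    then show ?thesis
    proof (elim disjE conjE exE)
      fix X assume "mixed V U B = V" and X: "bipartition V R X"
      then have "\<forall>y\<in>U. B\<inverse> `` {y} \<in> {{}, V, X, V - X}"
        using bipartite_columns[OF _ assms(1) X] by simp
      then show ?thesis using X unfolding bipartition_def aligned_def by blast
    qed blast
  qed
qed

section \<open>From alignment to types 7 and 8\<close>

lemma aligned_cut_type7:
  fixes B :: "('a \<times> 'b) set"
  assumes "aligned V U B" "B \<subseteq> V \<times> U"
  shows "cut_type7 V U B (V \<times> U - B)"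
proof -
  obtain C where C: "C \<subseteq> U" "\<And>x. x \<in> V \<Longrightarrow> B `` {x} \<in> {{}, U, C, U - C}"
    using assms(1) unfolding aligned_def by blast
  \<comment> \<open>The sets \<open>{}\<close>, \<open>U\<close>, \<open>C\<close>,
    \<open>U - C\<close> may coincide; removing the earlier classes keeps the four classes
    disjoint.\<close>
  define A3 where "A3 = {x \<in> V. B `` {x} = {}}"
  define A4 where "A4 = {x \<in> V. B `` {x} = U} - A3"
  define A1 where "A1 = {x \<in> V. B `` {x} = C} - A3 - A4"
  define A2 where "A2 = V - A1 - A3 - A4"
  have r3: "\<And>x. x \<in> A3 \<Longrightarrow> x \<in> V \<and> B `` {x} = {}" unfolding A3_def by blast
  have r4: "\<And>x. x \<in> A4 \<Longrightarrow> x \<in> V \<and> B `` {x} = U" unfolding A4_def by blast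
  have r1: "\<And>x. x \<in> A1 \<Longrightarrow> x \<in> V \<and> B `` {x} = C" unfolding A1_def by blast
  have r2: "x \<in> V \<and> B `` {x} = U - C" if "x \<in> A2" for x
    using that C(2)[of x] unfolding A2_def A1_def A4_def A3_def by blast
  have V: "V = A1 \<union> A2 \<union> A3 \<union> A4" using r1 r3 r4 unfolding A2_def by blast
  have disj: "A1 \<inter> A2 = {}" "A1 \<inter> A3 = {}" "A1 \<inter> A4 = {}" "A2 \<inter> A3 = {}" "A2 \<inter> A4 = {}" "A3 \<inter> A4 = {}"
    unfolding A2_def A1_def A4_def by blast+
  have part: "(x, y) \<in> B \<longleftrightarrow> y \<in> B `` {x}" for x y by simp
  have B: "B = (A1 \<times> C) \<union> (A2 \<times> (U - C)) \<union> (A4 \<times> U)"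
  proof (intro set_eqI)
    fix p :: "'a \<times> 'b"
    obtain x y where p: "p = (x, y)" by fastforce
    show "p \<in> B \<longleftrightarrow> p \<in> (A1 \<times> C) \<union> (A2 \<times> (U - C)) \<union> (A4 \<times> U)"
    proof (cases "x \<in> V")
      case True
      then consider "x \<in> A1" | "x \<in> A2" | "x \<in> A3" | "x \<in> A4" using V by blast
      then show ?thesis
        by cases (use r1[of x] r2[of x] r3[of x] r4[of x] disj p part[of x y] in auto)
    next
      case False
      then show ?thesis using p assms(2) V by auto
    qed
  qed
  have W: "V \<times> U - B = (A1 \<times> (U - C)) \<union> (A2 \<times> C) \<union> (A3 \<times> U)"
    unfolding B using V disj C(1) by blast
  have U: "U = C \<union> (U - C)" "C \<inter> (U - C) = {}" using C(1) by auto
  show ?thesis unfolding cut_type7_def using V disj U B W by blast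
qed

lemma cut_type7_converse:
  assumes "cut_type7 U V (B\<inverse>) (W\<inverse>)"
  shows "cut_type8 V U B W"
proof -
  obtain A1 A2 A3 A4 C D where U: "U = A1 \<union> A2 \<union> A3 \<union> A4"
    and disj: "A1 \<inter> A2 = {}" "A1 \<inter> A3 = {}" "A1 \<inter> A4 = {}" "A2 \<inter> A3 = {}" "A2 \<inter> A4 = {}" "A3 \<inter> A4 = {}"
    and V: "V = C \<union> D" "C \<inter> D = {}"
    and B: "B\<inverse> = (A1 \<times> C) \<union> (A2 \<times> D) \<union> (A4 \<times> V)"
    and W: "W\<inverse> = (A1 \<times> D) \<union> (A2 \<times> C) \<union> (A3 \<times> V)"
    using assms unfolding cut_type7_def by (elim exE conjE) (rule that)
  have "B = (C \<times> A1) \<union> (D \<times> A2) \<union> (V \<times> A4)"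
    using arg_cong[OF B, of converse] by (simp add: converse_Un converse_Times)
  moreover have "W = (C \<times> A2) \<union> (D \<times> A1) \<union> (V \<times> A3)"
    using arg_cong[OF W, of converse] by (simp add: converse_Un converse_Times Un_commute)
  ultimately show ?thesis unfolding cut_type8_def using U V disj
    by (intro exI[of _ C] exI[of _ D] exI[of _ A1] exI[of _ A2] exI[of _ A3] exI[of _ A4] conjI)
qed

section \<open>Arcs and reachability in simple graphs\<close>

definition arcs :: "'a set set \<Rightarrow> ('a \<times> 'a) set" where
  "arcs E = {(u, v). {u, v} \<in> E}"

lemma arcs_sym: "(u, v) \<in> arcs E \<Longrightarrow> (v, u) \<in> arcs E"
  unfolding arcs_def by (simp add: insert_commute)

lemma sym_arcs: "sym (arcs E)"
  by (rule symI) (rule arcs_sym)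

lemma arcs_sub:
  assumes "simple_graph V E"
  shows "arcs E \<subseteq> V \<times> V"
proof
  fix e assume "e \<in> arcs E"
  then obtain u v where e: "e = (u, v)" "{u, v} \<in> E" unfolding arcs_def by auto
  then obtain x y where "x \<in> V" "y \<in> V" "{u, v} = {x, y}" using assms unfolding simple_graph_def by metis
  then show "e \<in> V \<times> V" using e by (auto simp: doubleton_eq_iff)
qed

lemma arcs_irrefl:
  assumes "simple_graph V E"
  shows "(u, u) \<notin> arcs E"
proof
  assume "(u, u) \<in> arcs E"
  then have "{u, u} \<in> E" unfolding arcs_def by simp
  then obtain x y where "x \<noteq> y" "{u, u} = {x, y}" using assms unfolding simple_graph_def by metis
  then show False by (auto simp: doubleton_eq_iff)
qed

lemma reachable_arcs: "reachable E u v \<longleftrightarrow> (u, v) \<in> (arcs E)\<^sup>*"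
  unfolding reachable_def arcs_def ..

lemma reachable_sym: "reachable E u v \<Longrightarrow> reachable E v u"
  unfolding reachable_arcs
  by (rule symD[OF sym_rtrancl[OF sym_arcs]])

lemma reachable_trans: "reachable E u v \<Longrightarrow> reachable E v w \<Longrightarrow> reachable E u w"
  unfolding reachable_arcs by (rule rtrancl_trans)

lemma reachable_step: "reachable E u v \<Longrightarrow> {v, w} \<in> E \<Longrightarrow> reachable E u w"
  unfolding reachable_arcs by (erule rtrancl_into_rtrancl) (simp add: arcs_def)

lemma reachable_invariant:
  assumes "reachable E u v" "\<And>a b. {a, b} \<in> E \<Longrightarrow> P a \<Longrightarrow> P b" "P u"
  shows "P v"
  using assms(1) unfolding reachable_arcs
  by (induction rule: rtrancl_induct) (use assms(2,3) in \<open>auto simp: arcs_def\<close>)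

text \<open>The vertex attaining the minimum degree is kept for the singleton cut. With at least two
  vertices, connectedness makes this degree positive.\<close>

lemma connected_conn_graph:
  assumes "simple_graph V E" "connected_graph V E" "2 \<le> card V"
  shows "\<exists>\<delta>. conn_graph V (arcs E) \<delta> \<and> (\<exists>u\<in>V. card (arcs E `` {u}) = \<delta>)"
proof -
  have fin: "finite V" using assms(1) unfolding simple_graph_def by blast
  have ne: "V \<noteq> {}" using assms(3) by auto
  have conn: "\<exists>(u, v) \<in> arcs E. u \<in> X \<and> v \<notin> X" if X: "X \<subseteq> V" "X \<noteq> {}" "X \<noteq> V" for X
  proof (rule ccontr)
    assume none: "\<not> ?thesis"
    obtain u v where uv: "u \<in> X" "u \<in> V" "v \<in> V" "v \<notin> X" using X by blast
    then have "reachable E u v" using assms(2) unfolding connected_graph_def by blast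
    then have "v \<in> X"
      by (rule reachable_invariant) (use none uv in \<open>auto simp: arcs_def\<close>)
    then show False using uv by blast
  qed
  let ?d = "\<lambda>u. card (arcs E `` {u})"
  define \<delta> where "\<delta> = Min (?d ` V)"
  have "Min (?d ` V) \<in> ?d ` V" by (rule Min_in) (use fin ne in auto)
  then obtain u where u: "u \<in> V" "?d u = \<delta>" unfolding \<delta>_def by auto
  have "{u} \<noteq> V" using assms(3) by auto
  then obtain v where "(u, v) \<in> arcs E" using conn[of "{u}"] u by auto
  moreover have "finite (arcs E `` {u})"
    by (rule finite_subset[OF _ fin]) (use arcs_sub[OF assms(1)] in auto)
  ultimately have pos: "1 \<le> \<delta>" using u(2) by (auto simp: Suc_le_eq card_gt_0_iff)
  have "conn_graph V (arcs E) \<delta>"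
  proof
    show "finite V" "1 \<le> \<delta>" by (rule fin pos)+
    show "arcs E \<subseteq> V \<times> V" by (rule arcs_sub[OF assms(1)])
    show "(b, a) \<in> arcs E" if "(a, b) \<in> arcs E" for a b using that by (rule arcs_sym)
    show "(a, a) \<notin> arcs E" for a by (rule arcs_irrefl[OF assms(1)])
    show "\<exists>(a, b) \<in> arcs E. a \<in> X \<and> b \<notin> X" if "X \<subseteq> V" "X \<noteq> {}" "X \<noteq> V" for X
      using that by (rule conn)
    show "\<delta> \<le> ?d w" if "w \<in> V" for w
      unfolding \<delta>_def by (rule Min_le) (use fin that in auto)
  qed
  then show ?thesis using u by blast
qed

lemma dprod_arcs_iff:
  "{(x, y), (x', y')} \<in> dprod_E EG EH \<longleftrightarrow> (x, x') \<in> arcs EG \<and> (y, y') \<in> arcs EH"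
  unfolding dprod_E_def arcs_def by (auto simp: doubleton_eq_iff insert_commute)

text \<open>Reversing both arcs exchanges the crossings out of \<open>C\<close> with those into
  \<open>C\<close>.\<close>

lemma prod_cut_double:
  assumes "finite R" "finite Q" "sym R" "sym Q"
  shows "prod_cut R Q C
    = 2 * card {((x, x'), (y, y')) \<in> R \<times> Q. (x, y) \<in> C \<and> (x', y') \<notin> C}" (is "_ = 2 * card ?T")
proof -
  let ?T' = "{((x, x'), (y, y')) \<in> R \<times> Q. (x', y') \<in> C \<and> (x, y) \<notin> C}"
  have fin: "finite ?T" "finite ?T'"
    by (rule finite_subset[of _ "R \<times> Q"]; use assms in auto)+
  have "bij_betw (map_prod prod.swap prod.swap) ?T ?T'"
    by (rule bij_betw_byWitness[where f' = "map_prod prod.swap prod.swap"])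
      (use symD[OF assms(3)] symD[OF assms(4)] in auto)
  then have "card ?T = card ?T'" by (rule bij_betw_same_card)
  moreover have "{((x, x'), (y, y')) \<in> R \<times> Q. ((x, y) \<in> C) \<noteq> ((x', y') \<in> C)} = ?T \<union> ?T'" by auto
  moreover have "card (?T \<union> ?T') = card ?T + card ?T'"
    by (rule card_Un_disjoint[OF fin]) auto
  ultimately show ?thesis unfolding prod_cut_card[OF assms(1,2)] by simp
qed

section \<open>Edge boundaries and components\<close>

definition edge_boundary :: "'a set set \<Rightarrow> 'a set \<Rightarrow> 'a set set" where
  "edge_boundary E C = {{p, q} | p q. {p, q} \<in> E \<and> p \<in> C \<and> q \<notin> C}"

text \<open>A boundary edge has exactly one end in \<open>C\<close>, so exactly one pair of arcs
  represents it starting from there.\<close>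

lemma prod_cut_edge_boundary:
  assumes "finite (arcs EG)" "finite (arcs EH)"
  shows "prod_cut (arcs EG) (arcs EH) C = 2 * card (edge_boundary (dprod_E EG EH) C)"
proof -
  let ?T = "{((x, x'), (y, y')) \<in> arcs EG \<times> arcs EH. (x, y) \<in> C \<and> (x', y') \<notin> C}"
  let ?f = "\<lambda>((x, x'), (y, y')). {(x, y), (x', y')}"
  have inj: "inj_on ?f ?T" by (rule inj_onI) (auto simp: doubleton_eq_iff)
  have img: "?f ` ?T = edge_boundary (dprod_E EG EH) C"
  proof
    show "?f ` ?T \<subseteq> edge_boundary (dprod_E EG EH) C"
      unfolding edge_boundary_def using dprod_arcs_iff by fastforce
    show "edge_boundary (dprod_E EG EH) C \<subseteq> ?f ` ?T"
    proof
      fix e assume "e \<in> edge_boundary (dprod_E EG EH) C"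
      then obtain x y x' y' where e: "e = {(x, y), (x', y')}" "{(x, y), (x', y')} \<in> dprod_E EG EH"
        "(x, y) \<in> C" "(x', y') \<notin> C" unfolding edge_boundary_def by auto
      then have "((x, x'), (y, y')) \<in> ?T" by (simp add: dprod_arcs_iff)
      then have "?f ((x, x'), (y, y')) \<in> ?f ` ?T" by (rule imageI)
      then show "e \<in> ?f ` ?T" using e(1) by simp
    qed
  qed
  have "card (edge_boundary (dprod_E EG EH) C) = card ?T"
    unfolding img[symmetric] by (rule card_image[OF inj])
  then show ?thesis unfolding prod_cut_double[OF assms sym_arcs sym_arcs] by (simp only:)
qed

lemma edge_boundary_is_edge_cut:
  assumes "C \<subseteq> V" "C \<noteq> {}" "C \<noteq> V"
  shows "is_edge_cut V E (edge_boundary E C)"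
proof -
  obtain p q where pq: "p \<in> C" "p \<in> V" "q \<in> V" "q \<notin> C" using assms by blast
  have "\<not> reachable (E - edge_boundary E C) p q"
  proof
    assume "reachable (E - edge_boundary E C) p q"
    then have "q \<in> C"
      by (rule reachable_invariant) (use pq in \<open>auto simp: edge_boundary_def\<close>)
    then show False using pq by blast
  qed
  moreover have "edge_boundary E C \<subseteq> E" unfolding edge_boundary_def by auto
  ultimately show ?thesis unfolding is_edge_cut_def connected_graph_def using pq by blast
qed

lemma component_boundary_sub:
  assumes "is_component V (E - S) B" "\<And>p q. {p, q} \<in> E \<Longrightarrow> q \<in> V"
  shows "edge_boundary E B \<subseteq> S"
proof
  fix e assume "e \<in> edge_boundary E B"
  then obtain p q where e: "e = {p, q}" "{p, q} \<in> E" "p \<in> B" "q \<notin> B"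
    unfolding edge_boundary_def by blast
  obtain b where b: "B = {u \<in> V. reachable (E - S) b u}" using assms(1) unfolding is_component_def by blast
  show "e \<in> S"
  proof (rule ccontr)
    assume "e \<notin> S"
    then have "reachable (E - S) b q" using reachable_step[of "E - S" b p q] b e by blast
    then show False using b e assms(2) by blast
  qed
qed

lemma components_disjoint:
  assumes "is_component V E B" "is_component V E W" "B \<noteq> W"
  shows "B \<inter> W = {}"
proof (rule ccontr)
  assume "B \<inter> W \<noteq> {}"
  then obtain p where p: "p \<in> B" "p \<in> W" by blast
  obtain b w where bw: "B = {u \<in> V. reachable E b u}" "W = {u \<in> V. reachable E w u}"
    using assms unfolding is_component_def by blast
  have bp: "reachable E b p" "reachable E w p" using p bw by auto
  have bw_wb: "reachable E b w" "reachable E w b"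
    using reachable_trans[OF bp(1) reachable_sym[OF bp(2)]]
      reachable_trans[OF bp(2) reachable_sym[OF bp(1)]] .
  have "reachable E b u \<longleftrightarrow> reachable E w u" for u
    using reachable_trans[OF bw_wb(1), of u] reachable_trans[OF bw_wb(2), of u] by blast
  then show False using bw assms(3) by simp
qed

text \<open>A component cannot meet both sides of an invariant property, so two components covering
  both sides are the sides.\<close>

lemma component_cases:
  assumes B: "is_component V E B" and W: "is_component V E W" and cover: "B \<union> W = V"
    and inv: "\<And>p q. {p, q} \<in> E \<Longrightarrow> P p \<longleftrightarrow> P q" and ex: "\<exists>p\<in>V. P p" "\<exists>p\<in>V. \<not> P p"
  shows "B = {p \<in> V. P p} \<and> W = {p \<in> V. \<not> P p} \<or> W = {p \<in> V. P p} \<and> B = {p \<in> V. \<not> P p}"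
proof -
  have "(\<forall>p\<in>C. P p) \<or> (\<forall>p\<in>C. \<not> P p)" if C: "is_component V E C" for C
  proof -
    obtain c where c: "C = {u \<in> V. reachable E c u}" using C unfolding is_component_def by blast
    have "P u \<longleftrightarrow> P c" if "reachable E c u" for u
      using that by (rule reachable_invariant) (use inv in blast)+
    then show ?thesis using c by blast
  qed
  from this[OF B] this[OF W] show ?thesis using cover ex by blast
qed

lemma disconnected_split:
  assumes "\<not> connected_graph V E"
  shows "\<exists>X. X \<subseteq> V \<and> X \<noteq> {} \<and> X \<noteq> V \<and> (\<forall>x\<in>V. \<forall>x'\<in>V. {x, x'} \<in> E \<longrightarrow> (x \<in> X \<longleftrightarrow> x' \<in> X))"
proof -
  obtain u v where uv: "u \<in> V" "v \<in> V" "\<not> reachable E u v"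
    using assms unfolding connected_graph_def by blast
  let ?X = "{x \<in> V. reachable E u x}"
  have "reachable E u u" unfolding reachable_arcs by simp
  then have "u \<in> ?X" "v \<notin> ?X" using uv by auto
  moreover have "x \<in> ?X \<longleftrightarrow> x' \<in> ?X" if "x \<in> V" "x' \<in> V" "{x, x'} \<in> E" for x x'
    using reachable_step[of E u x x'] reachable_step[of E u x' x] that by (auto simp: insert_commute)
  ultimately show ?thesis using uv by (intro exI[of _ ?X]) blast
qed

lemma small_biclique_iso:
  assumes "small_biclique V (arcs E)"
  shows "graph_iso V E P3_V P3_E \<or> graph_iso V E C4_V C4_E"
proof -
  obtain X Y where V: "V = X \<union> Y" "X \<inter> Y = {}" and card: "card X = 2" "card Y \<in> {1, 2}"
    and R: "arcs E = X \<times> Y \<union> Y \<times> X" using assms unfolding small_biclique_def by blast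
  obtain a b where X: "X = {a, b}" "a \<noteq> b" using card(1) by (auto simp: card_2_iff)
  have E: "{u, v} \<in> E \<longleftrightarrow> (u, v) \<in> X \<times> Y \<union> Y \<times> X" for u v
    unfolding R[symmetric] arcs_def by simp
  consider c where "Y = {c}" | c d where "Y = {c, d}" "c \<noteq> d"
    using card(2) by (auto simp: card_1_singleton_iff card_2_iff)
  then show ?thesis
  proof cases
    case 1
    have ne: "a \<noteq> c" "b \<noteq> c" using V X 1 by auto
    define f where "f = (\<lambda>x. if x = a then 0 else if x = c then 1 else (2::nat))"
    have f: "f a = 0" "f c = 1" "f b = 2" unfolding f_def using ne X by auto
    have "bij_betw f V P3_V"
      unfolding bij_betw_def P3_V_def inj_on_def V(1) X 1 using f ne X by auto
    moreover have "\<forall>x\<in>V. \<forall>y\<in>V. {x, y} \<in> E \<longleftrightarrow> {f x, f y} \<in> P3_E"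
      unfolding E V(1) X 1 P3_E_def using f ne X by (auto simp: doubleton_eq_iff)
    ultimately show ?thesis unfolding graph_iso_def by blast
  next
    case 2
    have ne: "a \<noteq> c" "b \<noteq> c" "a \<noteq> d" "b \<noteq> d" using V X 2 by auto
    define f where "f = (\<lambda>x. if x = a then 0 else if x = c then 1 else if x = b then 2 else (3::nat))"
    have f: "f a = 0" "f c = 1" "f b = 2" "f d = 3" unfolding f_def using ne X 2 by auto
    have "bij_betw f V C4_V"
      unfolding bij_betw_def C4_V_def inj_on_def V(1) X 2 using f ne X 2 by auto
    moreover have "\<forall>x\<in>V. \<forall>y\<in>V. {x, y} \<in> E \<longleftrightarrow> {f x, f y} \<in> C4_E"
      unfolding E V(1) X 2 C4_E_def using f ne X 2 by (auto simp: doubleton_eq_iff)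
    ultimately show ?thesis unfolding graph_iso_def by blast
  qed
qed

section \<open>Classification of the minimum edge cuts of the product\<close>

theorem theorem1p2:
  fixes VG :: "'a set" and EG :: "'a set set" and VH :: "'b set" and EH :: "'b set set"
    and S :: "('a \<times> 'b) set set" and B W :: "('a \<times> 'b) set"
  assumes "simple_graph VG EG" and "simple_graph VH EH"
    and "\<not> graph_iso VG EG P3_V P3_E" and "\<not> graph_iso VG EG C4_V C4_E"
    and "\<not> graph_iso VH EH P3_V P3_E" and "\<not> graph_iso VH EH C4_V C4_E"
    and "is_min_edge_cut (dprod_V VG VH) (dprod_E EG EH) S"
    and "is_component (dprod_V VG VH) (dprod_E EG EH - S) B"
    and "is_component (dprod_V VG VH) (dprod_E EG EH - S) W"
    and "B \<noteq> W"
    and "B \<union> W = dprod_V VG VH"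
  shows "\<exists>k\<in>{1..8}. cut_type k VG VH B W \<or> cut_type k VG VH W B"
proof -
  let ?E = "dprod_E EG EH"
  have fin: "finite VG" "finite VH" using assms(1,2) unfolding simple_graph_def by auto
  have subR: "arcs EG \<subseteq> VG \<times> VG" and subQ: "arcs EH \<subseteq> VH \<times> VH"
    using arcs_sub assms(1,2) by auto
  have finR: "finite (arcs EG)" and finQ: "finite (arcs EH)"
    using finite_subset[OF subR] finite_subset[OF subQ] fin by auto
  have E_iff: "(fst p, fst q) \<in> arcs EG \<and> (snd p, snd q) \<in> arcs EH" if "{p, q} \<in> ?E" for p q
    using that dprod_arcs_iff[of "fst p" "snd p" "fst q" "snd q"] by simp
  have E_sub: "p \<in> VG \<times> VH \<and> q \<in> VG \<times> VH" if "{p, q} \<in> ?E" for p q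
    using E_iff[OF that] subR subQ by (auto simp: mem_Times_iff)
  have cover: "B \<union> W = VG \<times> VH" using assms(11) unfolding dprod_V_def .
  have B: "is_component (VG \<times> VH) (?E - S) B" and Wc: "is_component (VG \<times> VH) (?E - S) W"
    using assms(8,9) unfolding dprod_V_def .
  have disj: "B \<inter> W = {}" by (rule components_disjoint[OF B Wc assms(10)])
  have W: "W = VG \<times> VH - B" using cover disj by blast
  have B_sub: "B \<subseteq> VG \<times> VH" using cover by blast
  have refl: "reachable E' x x" for E' and x :: "'a \<times> 'b" unfolding reachable_arcs by simp
  have B_ne: "B \<noteq> {}" using B refl unfolding is_component_def by blast
  have ne: "VG \<noteq> {}" "VH \<noteq> {}" using B_ne B_sub by auto
  have alignedI: ?thesis if "aligned VG VH B \<or> aligned VH VG (B\<inverse>)"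
    using that
  proof
    assume "aligned VG VH B"
    then have "cut_type 7 VG VH B W"
      unfolding W cut_type_def using aligned_cut_type7[OF _ B_sub] by simp
    then show ?thesis by (intro bexI[of _ 7]) auto
  next
    assume "aligned VH VG (B\<inverse>)"
    moreover have "B\<inverse> \<subseteq> VH \<times> VG" using B_sub by auto
    moreover have "W\<inverse> = VH \<times> VG - B\<inverse>" unfolding W by auto
    ultimately have "cut_type7 VH VG (B\<inverse>) (W\<inverse>)" using aligned_cut_type7 by simp
    then have "cut_type 8 VG VH B W" unfolding cut_type_def using cut_type7_converse by simp
    then show ?thesis by (intro bexI[of _ 8]) auto
  qed
  \<comment> \<open>Connected factors with at least two vertices have positive minimum degree, as
    the counting requires; the other factors are settled directly.\<close>
  consider "card VG \<le> 1 \<or> card VH \<le> 1" | "\<not> connected_graph VG EG" | "\<not> connected_graph VH EH"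
    | "2 \<le> card VG" "2 \<le> card VH" "connected_graph VG EG" "connected_graph VH EH" by linarith
  then show ?thesis
  proof cases
    case 1
    have "card (mixed VG VH B) \<le> card VG" "card (mixed VH VG (B\<inverse>)) \<le> card VH"
      using card_mono[OF fin(1) mixed_sub] card_mono[OF fin(2) mixed_sub] by auto
    then have "card (mixed VG VH B) \<le> 1 \<or> card (mixed VH VG (B\<inverse>)) \<le> 1" using 1 by linarith
    moreover have "B\<inverse> \<subseteq> VH \<times> VG" using B_sub by auto
    ultimately show ?thesis
      using alignedI aligned_if_few_mixed[OF B_sub fin(1)] aligned_if_few_mixed[OF _ fin(2)] by blast
  next
    case 2
    then obtain X where X: "X \<subseteq> VG" "X \<noteq> {}" "X \<noteq> VG"
      "\<forall>x\<in>VG. \<forall>x'\<in>VG. {x, x'} \<in> EG \<longrightarrow> (x \<in> X \<longleftrightarrow> x' \<in> X)" using disconnected_split by metis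
    \<comment> \<open>The first coordinate of a product edge stays on one side of \<open>X\<close>,
      so the two components are the two unions of rows.\<close>
    have "B = {p \<in> VG \<times> VH. fst p \<in> X} \<and> W = {p \<in> VG \<times> VH. fst p \<notin> X}
      \<or> W = {p \<in> VG \<times> VH. fst p \<in> X} \<and> B = {p \<in> VG \<times> VH. fst p \<notin> X}"
    proof (rule component_cases[OF B Wc cover])
      fix p q assume "{p, q} \<in> ?E - S"
      then have "(fst p, fst q) \<in> arcs EG" using E_iff by blast
      then show "fst p \<in> X \<longleftrightarrow> fst q \<in> X" using X(4) subR unfolding arcs_def by auto
    next
      obtain y where "y \<in> VH" using ne by blast
      moreover obtain x where "x \<in> X" "x \<in> VG" using X by blast
      ultimately show "\<exists>p\<in>VG \<times> VH. fst p \<in> X" by (intro bexI[of _ "(x, y)"]) auto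
      obtain x' where "x' \<in> VG" "x' \<notin> X" using X by blast
      then show "\<exists>p\<in>VG \<times> VH. fst p \<notin> X" using \<open>y \<in> VH\<close> by (intro bexI[of _ "(x', y)"]) auto
    qed
    moreover have "{p \<in> VG \<times> VH. fst p \<in> X} = X \<times> VH" "{p \<in> VG \<times> VH. fst p \<notin> X} = (VG - X) \<times> VH"
      using X(1) by auto
    moreover have "VG = X \<union> (VG - X)" "X \<inter> (VG - X) = {}" using X(1) by auto
    ultimately have "cut_type1 VG VH B W \<or> cut_type1 VG VH W B"
      unfolding cut_type1_def by metis
    then show ?thesis unfolding cut_type_def by (intro bexI[of _ 1]) auto
  next
    case 3
    then obtain X where X: "X \<subseteq> VH" "X \<noteq> {}" "X \<noteq> VH"
      "\<forall>x\<in>VH. \<forall>x'\<in>VH. {x, x'} \<in> EH \<longrightarrow> (x \<in> X \<longleftrightarrow> x' \<in> X)" using disconnected_split by metis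
    have "B = {p \<in> VG \<times> VH. snd p \<in> X} \<and> W = {p \<in> VG \<times> VH. snd p \<notin> X}
      \<or> W = {p \<in> VG \<times> VH. snd p \<in> X} \<and> B = {p \<in> VG \<times> VH. snd p \<notin> X}"
    proof (rule component_cases[OF B Wc cover])
      fix p q assume "{p, q} \<in> ?E - S"
      then have "(snd p, snd q) \<in> arcs EH" using E_iff by blast
      then show "snd p \<in> X \<longleftrightarrow> snd q \<in> X" using X(4) subQ unfolding arcs_def by auto
    next
      obtain x where "x \<in> VG" using ne by blast
      moreover obtain y where "y \<in> X" "y \<in> VH" using X by blast
      ultimately show "\<exists>p\<in>VG \<times> VH. snd p \<in> X" by (intro bexI[of _ "(x, y)"]) auto
      obtain y' where "y' \<in> VH" "y' \<notin> X" using X by blast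
      then show "\<exists>p\<in>VG \<times> VH. snd p \<notin> X" using \<open>x \<in> VG\<close> by (intro bexI[of _ "(x, y')"]) auto
    qed
    moreover have "{p \<in> VG \<times> VH. snd p \<in> X} = VG \<times> X" "{p \<in> VG \<times> VH. snd p \<notin> X} = VG \<times> (VH - X)"
      using X(1) by auto
    moreover have "VH = X \<union> (VH - X)" "X \<inter> (VH - X) = {}" using X(1) by auto
    ultimately have "cut_type2 VG VH B W \<or> cut_type2 VG VH W B"
      unfolding cut_type2_def by metis
    then show ?thesis unfolding cut_type_def by (intro bexI[of _ 2]) auto
  next
    case 4
    obtain \<delta> u where G: "conn_graph VG (arcs EG) \<delta>" and u: "u \<in> VG" "card (arcs EG `` {u}) = \<delta>"
      using connected_conn_graph[OF assms(1) 4(3,1)] by blast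
    obtain \<epsilon> v where H: "conn_graph VH (arcs EH) \<epsilon>" and v: "v \<in> VH" "card (arcs EH `` {v}) = \<epsilon>"
      using connected_conn_graph[OF assms(2) 4(4,2)] by blast
    interpret two_graphs VG "arcs EG" \<delta> VH "arcs EH" \<epsilon>
      by (rule two_graphs.intro[OF G H])
    have "?E \<subseteq> Pow (VG \<times> VH)"
      unfolding dprod_E_def using subR subQ unfolding arcs_def by auto
    then have finE: "finite ?E" by (rule finite_subset) (use fin in auto)
    have S: "S \<subseteq> ?E" "\<And>S'. is_edge_cut (VG \<times> VH) ?E S' \<Longrightarrow> card S \<le> card S'"
      using assms(7) unfolding is_min_edge_cut_def is_edge_cut_def dprod_V_def by blast+
    have "edge_boundary ?E B \<subseteq> S" using component_boundary_sub[OF B] E_sub by blast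
    then have bS: "card (edge_boundary ?E B) \<le> card S"
      by (rule card_mono[OF finite_subset[OF S(1) finE]])
    \<comment> \<open>The boundary of \<open>B\<close> lies inside \<open>S\<close>, while that of a
      competitor is an edge cut and has at least \<open>card S\<close> edges.\<close>
    have min: "prod_cut (arcs EG) (arcs EH) B \<le> prod_cut (arcs EG) (arcs EH) C"
      if "C \<subseteq> VG \<times> VH" "C \<noteq> {}" "C \<noteq> VG \<times> VH" for C
      unfolding prod_cut_edge_boundary[OF finR finQ]
      using bS S(2)[OF edge_boundary_is_edge_cut[OF that]] by simp
    have single: "{(u, v)} \<noteq> VG \<times> VH"
    proof
      assume "{(u, v)} = VG \<times> VH"
      then have "card VG * card VH = 1" by (metis card_cartesian_product is_singletonI is_singleton_altdef)
      then show False using 4(1) by simp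
    qed
    \<comment> \<open>A product of two vertices of minimum degree has degree
      \<open>\<delta> * \<epsilon>\<close>; the factor 2 counts orientations.\<close>
    have "prod_cut (arcs EG) (arcs EH) {(u, v)} \<le> 2 * \<delta> * \<epsilon>"
    proof -
      let ?T = "{((x, x'), (y, y')) \<in> arcs EG \<times> arcs EH. (x, y) \<in> {(u, v)} \<and> (x', y') \<notin> {(u, v)}}"
      let ?P = "({u} \<times> arcs EG `` {u}) \<times> ({v} \<times> arcs EH `` {v})"
      have "?T \<subseteq> ?P" by auto
      then have "card ?T \<le> card ?P" by (rule card_mono[rotated]) simp
      also have "\<dots> = \<delta> * \<epsilon>" using u v by (simp add: card_cartesian_product)
      finally show ?thesis unfolding prod_cut_double[OF finR finQ sym_arcs sym_arcs] by linarith
    qed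
    moreover have "prod_cut (arcs EG) (arcs EH) B \<le> prod_cut (arcs EG) (arcs EH) {(u, v)}"
      by (rule min) (use u v single in auto)
    ultimately have le: "prod_cut (arcs EG) (arcs EH) B \<le> 2 * \<delta> * \<epsilon>" by linarith
    interpret min_prod_cut VG "arcs EG" \<delta> VH "arcs EH" \<epsilon> B
    proof
      show "B \<subseteq> VG \<times> VH" by (rule B_sub)
      show "prod_cut (arcs EG) (arcs EH) B \<le> 2 * \<delta> * \<epsilon>" by (rule le)
      show "prod_cut (arcs EG) (arcs EH) B \<le> prod_cut (arcs EG) (arcs EH) C"
        if "C \<subseteq> VG \<times> VH" "C \<noteq> {}" "C \<noteq> VG \<times> VH" for C using that by (rule min)
      show "\<not> small_biclique VG (arcs EG)" "\<not> small_biclique VH (arcs EH)"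
        using small_biclique_iso assms(3-6) by blast+
    qed
    show ?thesis by (rule alignedI[OF aligned_or_converse_aligned[OF ne]])
  qed
qed

end
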